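(* Let $S$ be an inverse semigroup and $\rho$ an idempotent pure congruence on $S$. Then there exist a fully strict partial action $\tau$ of the inverse semigroup $S/\rho$ on the meet semilattice $E(S)$ and an embedding (injective semigroup homomorphism) $\varphi: S\to E(S)\rtimes_\tau (S/\rho)$ such that: (i) the image $\varphi(S)$ coincides with $E(S)\rtimes^m_\tau (S/\rho)$; (ii) $\rho$ is induced by the epimorphism $\pi: E(S)\rtimes^m_\tau (S/\rho)\to S/\rho$, $(e,[s])\mapsto [s]$; that is, for all $s,t\in S$, $(s,t)\in\rho$ if and only if $\pi(\varphi(s))=\pi(\varphi(t))$; (iii) $\varphi$ is surjective onto $E(S)\rtimes_\tau (S/\rho)$ if and only if $\rho$ is a group congruence (i.e. $S/\rho$ is a group), equivalently, if and only if $S$ is $E$-unitary and $\rho=\sigma$.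
   Context: For an inverse semigroup $S$, $E(S)$ denotes its set of idempotents, $\le$ its natural partial order; $E(S)$ is a meet semilattice with $e\wedge f=ef$. For $s\in S$, $[s]\in S/\rho$ denotes the $\rho$-class of $s$. A congruence $\rho$ on $S$ is idempotent pure if $(e,s)\in\rho$ and $e\in E(S)$ imply $s\in E(S)$. The minimum group congruence $\sigma$ on $S$ is given by $(s,t)\in\sigma\iff \exists u\in S:\ u\le s$ and $u\le t$; $S$ is $E$-unitary if $\sigma$ is idempotent pure. For a set $X$, $\mathcal I(X)$ is the symmetric inverse monoid of partial bijections of $X$, with composition $(fg)(x)=f(g(x))$ on the largest domain where this makes sense; its natural partial order is inclusion of graphs. For inverse semigroups $S,T$, a premorphism $\tau:S\to T$ is a map with $\tau(s^{-1})=\tau(s)^{-1}$ and $\tau(s)\tau(t)\le\tau(st)$ for all $s,t\in S$. For a meet semilattice $E$, $\Sigma(E)$ is the inverse subsemigroup of $\mathcal I(E)$ consisting of the order isomorphisms between (possibly empty) order ideals (down-closed subsets) of $E$. A partial action $\tau$ of an inverse semigroup $S$ on a meet semilattice $E$ is a premorphism $\tau:S\to\Sigma(E)$, $s\mapsto\tau_s$. Given such $\tau$, $E\rtimes_\tau S=\{(e,s)\in E\times S\mid e\in\operatorname{ran}\tau_s\}$ with multiplication $(e,s)(f,t)=(\tau_s(\tau_s^{-1}(e)\wedge f),st)$; this is an inverse semigroup with $(e,s)^{-1}=(\tau_s^{-1}(e),s^{-1})$. The partial action $\tau$ is strict if for each $e\in E$ the set $\{f\in E(S)\mid e\in\operatorname{dom}\tau_f\}$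 has a minimum element, denoted $\alpha(e)$, and the map $\alpha:E\to E(S)$ is a homomorphism of meet semilattices. For strict $\tau$, $E\rtimes^m_\tau S=\{(e,s)\in E\rtimes_\tau S\mid \alpha(e)=ss^{-1}\}$, an inverse subsemigroup of $E\rtimes_\tau S$. A strict partial action $\tau$ is fully strict if the homomorphism $\pi:E\rtimes^m_\tau S\to S$, $(e,s)\mapsto s$, is surjective. *)

theory Defs
  imports "HOL-Algebra.Group"
begin

section \<open>Inverse semigroups\<close>

record 'a magma = "'a partial_object" +
  sg_mult :: "'a \<Rightarrow> 'a \<Rightarrow> 'a" (infixl "\<cdot>\<index>" 70)

text \<open>Semigroups are non-empty, as usual. (For the empty semigroup and the empty relation,
  ``\<open>S/\<rho>\<close> is a group'' would fail while ``\<open>S\<close> is \<open>E\<close>-unitary and \<open>\<rho> = \<sigma>\<close>'' would hold.)\<close>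

locale inverse_semigroup =
  fixes S :: "'a magma" (structure)
  assumes carrier_nonempty: "carrier S \<noteq> {}"
    and mult_closed: "\<lbrakk>x \<in> carrier S; y \<in> carrier S\<rbrakk> \<Longrightarrow> x \<cdot> y \<in> carrier S"
    and mult_assoc:
      "\<lbrakk>x \<in> carrier S; y \<in> carrier S; z \<in> carrier S\<rbrakk> \<Longrightarrow> (x \<cdot> y) \<cdot> z = x \<cdot> (y \<cdot> z)"
    and unique_inverse:
      "x \<in> carrier S \<Longrightarrow> \<exists>!y. y \<in> carrier S \<and> x \<cdot> y \<cdot> x = x \<and> y \<cdot> x \<cdot> y = y"

definition sinv :: "'a magma \<Rightarrow> 'a \<Rightarrow> 'a" where
  "sinv S x = (THE y. y \<in> carrier S \<and> x \<cdot>\<^bsub>S\<^esub> y \<cdot>\<^bsub>S\<^esub> x = x \<and> y \<cdot>\<^bsub>S\<^esub> x \<cdot>\<^bsub>S\<^esub> y = y)"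

definition idems :: "'a magma \<Rightarrow> 'a set" where
  "idems S = {e \<in> carrier S. e \<cdot>\<^bsub>S\<^esub> e = e}"

definition nat_le :: "'a magma \<Rightarrow> 'a \<Rightarrow> 'a \<Rightarrow> bool" where
  "nat_le S s t \<longleftrightarrow> s \<in> carrier S \<and> t \<in> carrier S \<and> (\<exists>e \<in> idems S. s = e \<cdot>\<^bsub>S\<^esub> t)"

text \<open>\<open>E(S)\<close> as an ordered set under the natural partial order; its meet is the product
  (lemma \<open>meet_idem_semilattice\<close>).\<close>

definition idem_semilattice :: "'a magma \<Rightarrow> 'a gorder" where
  "idem_semilattice S = \<lparr>carrier = idems S, eq = (=), le = nat_le S\<rparr>"

context inverse_semigroup
begin

lemma inverse_unique:
  assumes "x \<in> carrier S" "y \<in> carrier S" "x \<cdot> y \<cdot> x = x" "y \<cdot> x \<cdot> y = y"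
    "z \<in> carrier S" "x \<cdot> z \<cdot> x = x" "z \<cdot> x \<cdot> z = z"
  shows "y = z"
  using unique_inverse[OF assms(1)] assms by blast

lemma idems_mult_closed:
  assumes e: "e \<in> idems S" and f: "f \<in> idems S"
  shows "e \<cdot> f \<in> idems S"
proof -
  note [simp] = mult_closed mult_assoc
  have c[simp]: "e \<in> carrier S" "f \<in> carrier S" "e \<cdot> e = e" "f \<cdot> f = f"
    using e f by (auto simp: idems_def)
  have ee[simp]: "e \<cdot> (e \<cdot> z) = e \<cdot> z" and ff[simp]: "f \<cdot> (f \<cdot> z) = f \<cdot> z"
    if "z \<in> carrier S" for z
    using that by (metis c mult_assoc)+
  obtain x where x[simp]: "x \<in> carrier S"
    and x1: "(e \<cdot> f) \<cdot> x \<cdot> (e \<cdot> f) = e \<cdot> f" and x2: "x \<cdot> (e \<cdot> f) \<cdot> x = x"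
    using ex1_implies_ex[OF unique_inverse[OF mult_closed[OF c(1,2)]]] by (elim exE conjE)
  have x2': "x \<cdot> (e \<cdot> (f \<cdot> (x \<cdot> z))) = x \<cdot> z" if "z \<in> carrier S" for z
  proof -
    have "x \<cdot> (e \<cdot> (f \<cdot> (x \<cdot> z))) = (x \<cdot> (e \<cdot> f) \<cdot> x) \<cdot> z" using that by simp
    then show ?thesis by (simp only: x2)
  qed
  have x1': "e \<cdot> (f \<cdot> (x \<cdot> (e \<cdot> f))) = e \<cdot> f" and x2'': "x \<cdot> (e \<cdot> (f \<cdot> x)) = x"
    using x1 x2 by simp_all
  have fxe: "f \<cdot> x \<cdot> e = x"
    by (rule inverse_unique[of "e \<cdot> f"]) (simp_all add: x1' x2' x2'')
  have "x \<cdot> x = (f \<cdot> x \<cdot> e) \<cdot> (f \<cdot> x \<cdot> e)" by (simp only: fxe)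
  also have "\<dots> = f \<cdot> x \<cdot> e" by (simp add: x2')
  also have "\<dots> = x" by (fact fxe)
  finally have xx: "x \<cdot> x = x" .
  have "e \<cdot> f = x"
    by (rule inverse_unique[of x]) (simp_all add: x1' x2'' xx)
  with xx show ?thesis by (simp add: idems_def)
qed

lemma idems_commute:
  assumes e: "e \<in> idems S" and f: "f \<in> idems S"
  shows "e \<cdot> f = f \<cdot> e"
proof -
  note [simp] = mult_closed mult_assoc
  have c[simp]: "e \<in> carrier S" "f \<in> carrier S" "e \<cdot> e = e" "f \<cdot> f = f"
    using e f by (auto simp: idems_def)
  have ee[simp]: "e \<cdot> (e \<cdot> z) = e \<cdot> z" and ff[simp]: "f \<cdot> (f \<cdot> z) = f \<cdot> z"
    if "z \<in> carrier S" for z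
    using that by (metis c mult_assoc)+
  have "e \<cdot> (f \<cdot> (e \<cdot> f)) = e \<cdot> f" "f \<cdot> (e \<cdot> (f \<cdot> e)) = f \<cdot> e"
    using idems_mult_closed[OF e f] idems_mult_closed[OF f e] by (auto simp: idems_def)
  then show ?thesis
    by (intro inverse_unique[of "e \<cdot> f" "e \<cdot> f" "f \<cdot> e"]) simp_all
qed

lemma nat_le_idems:
  assumes e: "e \<in> idems S" and f: "f \<in> idems S"
  shows "nat_le S e f \<longleftrightarrow> e \<cdot> f = e"
proof
  assume "nat_le S e f"
  then obtain g where "g \<in> idems S" "e = g \<cdot> f" by (auto simp: nat_le_def)
  then show "e \<cdot> f = e" using f by (simp add: idems_def mult_assoc)
next
  assume "e \<cdot> f = e"
  then show "nat_le S e f" using e f by (force simp: nat_le_def idems_def)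
qed

lemma lower_semilattice_idem_semilattice: "lower_semilattice (idem_semilattice S)"
  and meet_idem_semilattice:
    "\<lbrakk>e \<in> idems S; f \<in> idems S\<rbrakk> \<Longrightarrow> e \<sqinter>\<^bsub>idem_semilattice S\<^esub> f = e \<cdot> f"
proof -
  let ?E = "idem_semilattice S"
  have [simp]: "carrier ?E = idems S" "(.=\<^bsub>?E\<^esub>) = (=)" "(\<sqsubseteq>\<^bsub>?E\<^esub>) = nat_le S"
    by (simp_all add: idem_semilattice_def)
  have cl: "x \<in> idems S \<Longrightarrow> x \<in> carrier S" "x \<in> idems S \<Longrightarrow> x \<cdot> x = x" for x
    by (auto simp: idems_def)
  have po: "partial_order ?E"
  proof
    fix x y z assume "x \<in> carrier ?E" "y \<in> carrier ?E" "z \<in> carrier ?E"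
      "x \<sqsubseteq>\<^bsub>?E\<^esub> y" "y \<sqsubseteq>\<^bsub>?E\<^esub> z"
    then show "x \<sqsubseteq>\<^bsub>?E\<^esub> z" by (simp add: nat_le_idems) (metis cl(1) mult_assoc)
  next
    fix x y assume "x \<in> carrier ?E" "y \<in> carrier ?E" "x \<sqsubseteq>\<^bsub>?E\<^esub> y" "y \<sqsubseteq>\<^bsub>?E\<^esub> x"
    then show "x .=\<^bsub>?E\<^esub> y" by (simp add: nat_le_idems) (metis idems_commute)
  qed (auto simp: nat_le_idems cl)
  interpret partial_order ?E by (fact po)
  have g: "greatest ?E (e \<cdot> f) (Lower ?E {e, f})" if "e \<in> idems S" "f \<in> idems S" for e f
  proof (rule greatest_LowerI)
    have ef: "e \<cdot> f \<in> idems S" using that by (rule idems_mult_closed)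
    show "e \<cdot> f \<in> carrier ?E" using ef by simp
    show "e \<cdot> f \<sqsubseteq>\<^bsub>?E\<^esub> x" if x: "x \<in> {e, f}" for x
    proof -
      have xi: "x \<in> idems S" using x \<open>e \<in> idems S\<close> \<open>f \<in> idems S\<close> by auto
      have "e \<cdot> f \<cdot> x = e \<cdot> f"
        using x that \<open>e \<in> idems S\<close> \<open>f \<in> idems S\<close>
        by (metis cl idems_commute insert_iff mult_assoc singletonD)
      then show ?thesis using xi ef by (simp add: nat_le_idems)
    qed
    show "y \<sqsubseteq>\<^bsub>?E\<^esub> e \<cdot> f" if y: "y \<in> Lower ?E {e, f}" for y
    proof -
      have yi: "y \<in> idems S" using y by (auto simp: Lower_def)
      have "y \<cdot> e = y" "y \<cdot> f = y"
        using y yi \<open>e \<in> idems S\<close> \<open>f \<in> idems S\<close> by (auto simp: Lower_def nat_le_idems)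
      then have "y \<cdot> (e \<cdot> f) = y"
        using yi \<open>e \<in> idems S\<close> \<open>f \<in> idems S\<close> by (metis cl(1) mult_assoc)
      then show ?thesis using ef yi by (simp add: nat_le_idems)
    qed
  qed (use that in auto)
  show "lower_semilattice ?E"
  proof (intro lower_semilattice.intro lower_semilattice_axioms.intro)
    fix x y assume "x \<in> carrier ?E" "y \<in> carrier ?E"
    then show "\<exists>s. greatest ?E s (Lower ?E {x, y})" using g[of x y] by auto
  qed (fact po)
  show "e \<sqinter>\<^bsub>?E\<^esub> f = e \<cdot> f" if "e \<in> idems S" "f \<in> idems S"
    unfolding meet_def inf_def
    by (rule some_equality, rule g[OF that], rule greatest_unique[OF _ g[OF that]])
qed

end

definition sg_hom :: "'a magma \<Rightarrow> 'b magma \<Rightarrow> ('a \<Rightarrow> 'b) set" where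
  "sg_hom S T = {h \<in> carrier S \<rightarrow> carrier T.
     \<forall>x \<in> carrier S. \<forall>y \<in> carrier S. h (x \<cdot>\<^bsub>S\<^esub> y) = h x \<cdot>\<^bsub>T\<^esub> h y}"

definition is_group :: "'a magma \<Rightarrow> bool" where
  "is_group S \<longleftrightarrow> (\<exists>u. group \<lparr>carrier = carrier S, mult = sg_mult S, one = u\<rparr>)"


section \<open>Congruences\<close>

definition congruence :: "'a magma \<Rightarrow> ('a \<times> 'a) set \<Rightarrow> bool" where
  "congruence S \<rho> \<longleftrightarrow> equiv (carrier S) \<rho> \<and>
     (\<forall>(s, s') \<in> \<rho>. \<forall>(t, t') \<in> \<rho>. (s \<cdot>\<^bsub>S\<^esub> t, s' \<cdot>\<^bsub>S\<^esub> t') \<in> \<rho>)"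

text \<open>\<open>S/\<rho>\<close>; the class \<open>[s]\<close> is \<open>\<rho> `` {s}\<close>.\<close>

definition quot :: "'a magma \<Rightarrow> ('a \<times> 'a) set \<Rightarrow> 'a set magma" where
  "quot S \<rho> = \<lparr>carrier = carrier S // \<rho>,
               sg_mult = (\<lambda>A B. \<Union>a \<in> A. \<Union>b \<in> B. \<rho> `` {a \<cdot>\<^bsub>S\<^esub> b})\<rparr>"

definition idempotent_pure :: "'a magma \<Rightarrow> ('a \<times> 'a) set \<Rightarrow> bool" where
  "idempotent_pure S \<rho> \<longleftrightarrow> (\<forall>e s. (e, s) \<in> \<rho> \<and> e \<in> idems S \<longrightarrow> s \<in> idems S)"

definition group_congruence :: "'a magma \<Rightarrow> ('a \<times> 'a) set \<Rightarrow> bool" where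
  "group_congruence S \<rho> \<longleftrightarrow> congruence S \<rho> \<and> is_group (quot S \<rho>)"

definition min_group_cong :: "'a magma \<Rightarrow> ('a \<times> 'a) set" where
  "min_group_cong S = {(s, t). \<exists>u. nat_le S u s \<and> nat_le S u t}"

definition E_unitary :: "'a magma \<Rightarrow> bool" where
  "E_unitary S \<longleftrightarrow> idempotent_pure S (min_group_cong S)"


section \<open>Partial bijections\<close>

text \<open>Partial bijections of \<open>X\<close> are injective partial functions \<open>'a \<rightharpoonup> 'a\<close> with domain and range
  inside \<open>X\<close>; \<open>f \<circ>\<^sub>m g\<close> applies \<open>g\<close> first.\<close>

definition sym_inv_monoid :: "'a set \<Rightarrow> ('a \<rightharpoonup> 'a) magma" where
  "sym_inv_monoid X =
     \<lparr>carrier = {f. dom f \<subseteq> X \<and> ran f \<subseteq> X \<and> inj_on f (dom f)}, sg_mult = (\<circ>\<^sub>m)\<rparr>"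

definition pinv :: "('a \<rightharpoonup> 'b) \<Rightarrow> ('b \<rightharpoonup> 'a)" where
  "pinv f y = (if y \<in> ran f then Some (THE x. f x = Some y) else None)"

definition order_ideal :: "('a, 'c) gorder_scheme \<Rightarrow> 'a set \<Rightarrow> bool" where
  "order_ideal E I \<longleftrightarrow> I \<subseteq> carrier E \<and> (\<forall>x \<in> I. \<forall>y \<in> carrier E. y \<sqsubseteq>\<^bsub>E\<^esub> x \<longrightarrow> y \<in> I)"

definition Sigma_sl :: "'a gorder \<Rightarrow> ('a \<rightharpoonup> 'a) magma" where
  "Sigma_sl E = (sym_inv_monoid (carrier E))
     \<lparr>carrier := {f \<in> carrier (sym_inv_monoid (carrier E)).
        order_ideal E (dom f) \<and> order_ideal E (ran f) \<and>
        (\<forall>x \<in> dom f. \<forall>y \<in> dom f. x \<sqsubseteq>\<^bsub>E\<^esub> y \<longleftrightarrow> the (f x) \<sqsubseteq>\<^bsub>E\<^esub> the (f y))}\<rparr>"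

text \<open>In \<open>\<Sigma>(E)\<close> the semigroup-theoretic inverse and natural partial order are the inverse
  partial bijection and inclusion of graphs.\<close>

lemma pinv_eq_Some:
  assumes "inj_on f (dom f)"
  shows "pinv f y = Some x \<longleftrightarrow> f x = Some y"
proof -
  have u: "a = b" if "f a = Some y" "f b = Some y" for a b
    using assms that by (intro inj_onD[OF assms]) auto
  have "(THE z. f z = Some y) = a" if "f a = Some y" for a
    using that u by blast
  then show ?thesis by (auto simp: pinv_def ran_def)
qed

context
  fixes E :: "'a gorder"
begin

lemma Sigma_mult [simp]: "f \<cdot>\<^bsub>Sigma_sl E\<^esub> g = f \<circ>\<^sub>m g"
  by (simp add: Sigma_sl_def sym_inv_monoid_def)

lemma Sigma_carrierD:
  assumes "f \<in> carrier (Sigma_sl E)"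
  shows "dom f \<subseteq> carrier E" "ran f \<subseteq> carrier E" "inj_on f (dom f)"
    "order_ideal E (dom f)" "order_ideal E (ran f)"
    "\<lbrakk>f x = Some x'; f y = Some y'\<rbrakk> \<Longrightarrow> x \<sqsubseteq>\<^bsub>E\<^esub> y \<longleftrightarrow> x' \<sqsubseteq>\<^bsub>E\<^esub> y'"
proof -
  show "x \<sqsubseteq>\<^bsub>E\<^esub> y \<longleftrightarrow> x' \<sqsubseteq>\<^bsub>E\<^esub> y'" if "f x = Some x'" "f y = Some y'"
  proof -
    have "x \<in> dom f" "y \<in> dom f" using that by auto
    then have "x \<sqsubseteq>\<^bsub>E\<^esub> y \<longleftrightarrow> the (f x) \<sqsubseteq>\<^bsub>E\<^esub> the (f y)"
      using assms by (simp add: Sigma_sl_def)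
    then show ?thesis using that by simp
  qed
qed (use assms in \<open>auto simp: Sigma_sl_def sym_inv_monoid_def\<close>)

lemma pinv_in_Sigma:
  assumes f: "f \<in> carrier (Sigma_sl E)"
  shows "pinv f \<in> carrier (Sigma_sl E)"
proof -
  note D = Sigma_carrierD[OF f]
  note P = pinv_eq_Some[OF D(3)]
  have "dom (pinv f) = ran f" by (auto simp: dom_def ran_def P)
  moreover have "ran (pinv f) = dom f" by (auto simp: dom_def ran_def P)
  moreover have "inj_on (pinv f) (dom (pinv f))" by (rule inj_onI) (auto simp: P)
  moreover have "x \<sqsubseteq>\<^bsub>E\<^esub> y \<longleftrightarrow> the (pinv f x) \<sqsubseteq>\<^bsub>E\<^esub> the (pinv f y)"
    if xy: "x \<in> dom (pinv f)" "y \<in> dom (pinv f)" for x y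
  proof -
    obtain x' y' where *: "pinv f x = Some x'" "pinv f y = Some y'" using xy by auto
    then have "f x' = Some x" "f y' = Some y" by (simp_all add: P)
    then show ?thesis using D(6) * by simp
  qed
  ultimately show ?thesis using D(1-5) by (simp add: Sigma_sl_def sym_inv_monoid_def)
qed

lemma sinv_Sigma:
  assumes f: "f \<in> carrier (Sigma_sl E)"
  shows "sinv (Sigma_sl E) f = pinv f"
  unfolding sinv_def
proof (rule the_equality)
  note P = pinv_eq_Some[OF Sigma_carrierD(3)[OF f]]
  have 1: "f \<circ>\<^sub>m pinv f \<circ>\<^sub>m f = f"
  proof
    fix x show "(f \<circ>\<^sub>m pinv f \<circ>\<^sub>m f) x = f x"
      using P by (cases "f x") (auto simp: map_comp_def split: option.splits)
  qed
  have 2: "pinv f \<circ>\<^sub>m f \<circ>\<^sub>m pinv f = pinv f"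
  proof
    fix x show "(pinv f \<circ>\<^sub>m f \<circ>\<^sub>m pinv f) x = pinv f x"
      using P by (cases "pinv f x") (auto simp: map_comp_def split: option.splits)
  qed
  show "pinv f \<in> carrier (Sigma_sl E) \<and> f \<cdot>\<^bsub>Sigma_sl E\<^esub> pinv f \<cdot>\<^bsub>Sigma_sl E\<^esub> f = f \<and>
      pinv f \<cdot>\<^bsub>Sigma_sl E\<^esub> f \<cdot>\<^bsub>Sigma_sl E\<^esub> pinv f = pinv f"
    using 1 2 pinv_in_Sigma[OF f] by simp
  fix g assume "g \<in> carrier (Sigma_sl E) \<and> f \<cdot>\<^bsub>Sigma_sl E\<^esub> g \<cdot>\<^bsub>Sigma_sl E\<^esub> f = f \<and>
      g \<cdot>\<^bsub>Sigma_sl E\<^esub> f \<cdot>\<^bsub>Sigma_sl E\<^esub> g = g"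
  then have g: "g \<in> carrier (Sigma_sl E)" and
    fgf: "f \<circ>\<^sub>m g \<circ>\<^sub>m f = f" and gfg: "g \<circ>\<^sub>m f \<circ>\<^sub>m g = g" by auto
  note Q = pinv_eq_Some[OF Sigma_carrierD(3)[OF g]]
  have A: "g y = Some x" if h: "f x = Some y" for x y
  proof -
    have "(f \<circ>\<^sub>m g \<circ>\<^sub>m f) x = Some y" using h fgf by simp
    then obtain z where "g y = Some z" "f z = Some y"
      using h by (auto simp: map_comp_Some_iff)
    then show ?thesis using P h by (metis option.inject)
  qed
  have B: "f x = Some y" if h: "g y = Some x" for x y
  proof -
    have "(g \<circ>\<^sub>m f \<circ>\<^sub>m g) y = Some x" using h gfg by simp
    then obtain z where "f x = Some z" "g z = Some x"
      using h by (auto simp: map_comp_Some_iff)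
    then show ?thesis using Q h by (metis option.inject)
  qed
  show "g = pinv f"
  proof
    fix y show "g y = pinv f y"
      using A B P by (metis not_Some_eq)
  qed
qed

lemma nat_le_Sigma:
  assumes f: "f \<in> carrier (Sigma_sl E)" and g: "g \<in> carrier (Sigma_sl E)"
  shows "nat_le (Sigma_sl E) f g \<longleftrightarrow> f \<subseteq>\<^sub>m g"
proof
  assume "nat_le (Sigma_sl E) f g"
  then obtain e where e: "e \<in> carrier (Sigma_sl E)" "e \<circ>\<^sub>m e = e" "f = e \<circ>\<^sub>m g"
    by (auto simp: nat_le_def idems_def)
  have id: "y = x" if "e x = Some y" for x y
  proof -
    have "(e \<circ>\<^sub>m e) x = Some y" using that e(2) by simp
    then have "e y = Some y" using that by (simp add: map_comp_Some_iff)
    then show ?thesis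
      using that pinv_eq_Some[OF Sigma_carrierD(3)[OF e(1)]] by (metis option.inject)
  qed
  show "f \<subseteq>\<^sub>m g" unfolding map_le_def
  proof
    fix x assume "x \<in> dom f"
    then show "f x = g x" using e(3) id by (auto simp: map_comp_Some_iff)
  qed
next
  assume le: "f \<subseteq>\<^sub>m g"
  note D = Sigma_carrierD[OF f]
  define e where "e = (\<lambda>x. if x \<in> ran f then Some x else None)"
  have "dom e = ran f" "ran e = ran f" by (auto simp: e_def ran_def dom_def split: if_splits)
  moreover have "inj_on e (dom e)" by (auto simp: inj_on_def e_def split: if_splits)
  ultimately have "e \<in> carrier (Sigma_sl E)"
    using D by (auto simp: Sigma_sl_def sym_inv_monoid_def e_def)
  moreover have "e \<circ>\<^sub>m e = e" by (auto simp: e_def map_comp_def fun_eq_iff)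
  moreover have "f = e \<circ>\<^sub>m g"
  proof
    fix x
    show "f x = (e \<circ>\<^sub>m g) x"
    proof (cases "f x")
      case (Some y)
      then have "g x = Some y" using le by (auto simp: map_le_def dom_def)
      then show ?thesis using Some by (auto simp: map_comp_def e_def ran_def)
    next
      case None
      have False if h: "g x = Some y" "y \<in> ran f" for y
      proof -
        obtain z where z: "f z = Some y" using h(2) by (auto simp: ran_def)
        then have "g z = Some y" using le by (auto simp: map_le_def dom_def)
        then have "z = x" using h(1) pinv_eq_Some[OF Sigma_carrierD(3)[OF g]]
          by (metis option.inject)
        then show False using z None by simp
      qed
      then show ?thesis using None by (auto simp: map_comp_def e_def split: option.splits)
    qed
  qed
  ultimately show "nat_le (Sigma_sl E) f g" using f g
    by (auto simp: nat_le_def idems_def)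
qed

end



section \<open>Partial actions\<close>

definition premorphism :: "'a magma \<Rightarrow> 'b magma \<Rightarrow> ('a \<Rightarrow> 'b) \<Rightarrow> bool" where
  "premorphism S T \<tau> \<longleftrightarrow> \<tau> \<in> carrier S \<rightarrow> carrier T \<and>
     (\<forall>s \<in> carrier S. \<tau> (sinv S s) = sinv T (\<tau> s)) \<and>
     (\<forall>s \<in> carrier S. \<forall>t \<in> carrier S. nat_le T (\<tau> s \<cdot>\<^bsub>T\<^esub> \<tau> t) (\<tau> (s \<cdot>\<^bsub>S\<^esub> t)))"

definition partial_action :: "'s magma \<Rightarrow> 'e gorder \<Rightarrow> ('s \<Rightarrow> 'e \<rightharpoonup> 'e) \<Rightarrow> bool" where
  "partial_action S E \<tau> \<longleftrightarrow>
     inverse_semigroup S \<and> lower_semilattice E \<and> premorphism S (Sigma_sl E) \<tau>"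

definition semidirect :: "'e gorder \<Rightarrow> ('s \<Rightarrow> 'e \<rightharpoonup> 'e) \<Rightarrow> 's magma \<Rightarrow> ('e \<times> 's) magma" where
  "semidirect E \<tau> S =
     \<lparr>carrier = {(e, s). e \<in> carrier E \<and> s \<in> carrier S \<and> e \<in> ran (\<tau> s)},
      sg_mult = (\<lambda>(e, s) (f, t).
        (the (\<tau> s (the (pinv (\<tau> s) e) \<sqinter>\<^bsub>E\<^esub> f)), s \<cdot>\<^bsub>S\<^esub> t))\<rparr>"

definition dom_idems :: "'s magma \<Rightarrow> ('s \<Rightarrow> 'e \<rightharpoonup> 'e) \<Rightarrow> 'e \<Rightarrow> 's set" where
  "dom_idems S \<tau> e = {f \<in> idems S. e \<in> dom (\<tau> f)}"

definition strict_alpha :: "'s magma \<Rightarrow> ('s \<Rightarrow> 'e \<rightharpoonup> 'e) \<Rightarrow> 'e \<Rightarrow> 's" where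
  "strict_alpha S \<tau> e = (THE f. least (idem_semilattice S) f (dom_idems S \<tau> e))"

definition strict_partial_action :: "'s magma \<Rightarrow> 'e gorder \<Rightarrow> ('s \<Rightarrow> 'e \<rightharpoonup> 'e) \<Rightarrow> bool" where
  "strict_partial_action S E \<tau> \<longleftrightarrow> partial_action S E \<tau> \<and>
     (\<forall>e \<in> carrier E. \<exists>f. least (idem_semilattice S) f (dom_idems S \<tau> e)) \<and>
     (\<forall>e \<in> carrier E. \<forall>f \<in> carrier E. strict_alpha S \<tau> (e \<sqinter>\<^bsub>E\<^esub> f) =
        strict_alpha S \<tau> e \<sqinter>\<^bsub>idem_semilattice S\<^esub> strict_alpha S \<tau> f)"

definition semidirect_m :: "'e gorder \<Rightarrow> ('s \<Rightarrow> 'e \<rightharpoonup> 'e) \<Rightarrow> 's magma \<Rightarrow> ('e \<times> 's) magma" where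
  "semidirect_m E \<tau> S = (semidirect E \<tau> S)
     \<lparr>carrier := {(e, s) \<in> carrier (semidirect E \<tau> S). strict_alpha S \<tau> e = s \<cdot>\<^bsub>S\<^esub> sinv S s}\<rparr>"

definition fully_strict_partial_action ::
    "'s magma \<Rightarrow> 'e gorder \<Rightarrow> ('s \<Rightarrow> 'e \<rightharpoonup> 'e) \<Rightarrow> bool" where
  "fully_strict_partial_action S E \<tau> \<longleftrightarrow> strict_partial_action S E \<tau> \<and>
     snd ` carrier (semidirect_m E \<tau> S) = carrier S"

end

(* Let a class A of rho act on E(S) by conjugation with the elements lying below some member of A:
   e goes to u u* for such u with u* u = e. Idempotent purity makes u unique, since rho-related
   elements with the same domain idempotent are equal. The least idempotent class whose action is
   defined at e is [e], so s |-> (s s*, [s]) is a bijection onto the strict part of the semidirect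
   product; it hits all pairs exactly when [e] = [f] for all idempotents e, f. *)

theory Submission
  imports Defs
begin

section \<open>Calculus in an inverse semigroup\<close>

text \<open>The members of A alone would not give an action: their domain idempotents need not form
  an order ideal, so their restrictions have to be added. The price is that an element u below A may
  lie outside A; in general only [u] = [u u^-1] A. A pair (e, A) of the semidirect product thus
  stands for an element u below A with range e, and one u may occur with several A. The condition
  [e] = A A^-1 that cuts out the strict part says exactly that u lies in A itself. The embedding
  therefore misses precisely the pairs whose u has left its class. Products of elements below A and
  below B lie below AB but need not exhaust what lies below AB, so the action is in general only a
  premorphism.\<close>

lemma inverse_semigroupI:
  fixes T (structure)
  assumes ne: "carrier T \<noteq> {}"
    and cl: "\<And>x y. \<lbrakk>x \<in> carrier T; y \<in> carrier T\<rbrakk> \<Longrightarrow> x \<cdot> y \<in> carrier T"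
    and as: "\<And>x y z. \<lbrakk>x \<in> carrier T; y \<in> carrier T; z \<in> carrier T\<rbrakk> \<Longrightarrow> (x \<cdot> y) \<cdot> z = x \<cdot> (y \<cdot> z)"
    and reg: "\<And>x. x \<in> carrier T \<Longrightarrow> \<exists>y\<in>carrier T. x \<cdot> y \<cdot> x = x \<and> y \<cdot> x \<cdot> y = y"
    and com: "\<And>e f. \<lbrakk>e \<in> idems T; f \<in> idems T\<rbrakk> \<Longrightarrow> e \<cdot> f = f \<cdot> e"
  shows "inverse_semigroup T"
proof
  fix x assume x: "x \<in> carrier T"
  have idem: "a \<cdot> b \<in> idems T" if "a \<in> carrier T" "b \<in> carrier T" "a \<cdot> b \<cdot> a = a" for a b
    using that by (simp add: idems_def cl flip: as)
  have "y = z" if y: "y \<in> carrier T" "x \<cdot> y \<cdot> x = x" "y \<cdot> x \<cdot> y = y"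
    and z: "z \<in> carrier T" "x \<cdot> z \<cdot> x = x" "z \<cdot> x \<cdot> z = z" for y z
  proof -
    have i: "x \<cdot> y \<in> idems T" "x \<cdot> z \<in> idems T" "y \<cdot> x \<in> idems T" "z \<cdot> x \<in> idems T"
      using x y z by (auto intro: idem)
    \<comment> \<open>Two inverses y and z of x agree because x y commutes with x z, which turns y
      into y x z, and y x commutes with z x, which turns y x z into z.\<close>
    have "y = y \<cdot> ((x \<cdot> z) \<cdot> (x \<cdot> y))" using x y z by (metis as cl)
    also have "\<dots> = y \<cdot> ((x \<cdot> y) \<cdot> (x \<cdot> z))" using com i by metis
    also have "\<dots> = (y \<cdot> x) \<cdot> z" using x y z by (metis as cl)
    also have "\<dots> = ((y \<cdot> x) \<cdot> (z \<cdot> x)) \<cdot> z" using x y z by (metis as cl)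
    also have "\<dots> = ((z \<cdot> x) \<cdot> (y \<cdot> x)) \<cdot> z" using com i by metis
    also have "\<dots> = z" using x y z by (metis as cl)
    finally show ?thesis .
  qed
  then show "\<exists>!y. y \<in> carrier T \<and> x \<cdot> y \<cdot> x = x \<and> y \<cdot> x \<cdot> y = y"
    using reg[OF x] by blast
qed (fact ne cl as)+

context inverse_semigroup
begin

abbreviation inverse_of :: "'a \<Rightarrow> 'a" ("(_\<^sup>\<star>)" [1000] 1000)
  where "x\<^sup>\<star> \<equiv> sinv S x"

lemma sinv_props:
  assumes "x \<in> carrier S"
  shows "x\<^sup>\<star> \<in> carrier S" "x \<cdot> x\<^sup>\<star> \<cdot> x = x" "x\<^sup>\<star> \<cdot> x \<cdot> x\<^sup>\<star> = x\<^sup>\<star>"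
  using theI'[OF unique_inverse[OF assms]] by (auto simp: sinv_def)

lemma sinv_eqI:
  "\<lbrakk>x \<in> carrier S; y \<in> carrier S; x \<cdot> y \<cdot> x = x; y \<cdot> x \<cdot> y = y\<rbrakk> \<Longrightarrow> x\<^sup>\<star> = y"
  by (rule inverse_unique[OF _ _ sinv_props(2,3)]) (simp_all add: sinv_props)

lemma idems_carrier: "e \<in> idems S \<Longrightarrow> e \<in> carrier S"
  by (simp add: idems_def)

text \<open>The versions with a trailing \<open>z\<close> let the cancellation laws fire inside
  right-nested products, the normal form produced by \<open>mult_assoc\<close>.\<close>

lemma sinv_cancel:
  assumes "x \<in> carrier S"
  shows "x \<cdot> (x\<^sup>\<star> \<cdot> x) = x" and "x\<^sup>\<star> \<cdot> (x \<cdot> x\<^sup>\<star>) = x\<^sup>\<star>"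
    and "z \<in> carrier S \<Longrightarrow> x \<cdot> (x\<^sup>\<star> \<cdot> (x \<cdot> z)) = x \<cdot> z"
    and "z \<in> carrier S \<Longrightarrow> x\<^sup>\<star> \<cdot> (x \<cdot> (x\<^sup>\<star> \<cdot> z)) = x\<^sup>\<star> \<cdot> z"
proof -
  note p = sinv_props[OF assms]
  show "x \<cdot> (x\<^sup>\<star> \<cdot> x) = x" "x\<^sup>\<star> \<cdot> (x \<cdot> x\<^sup>\<star>) = x\<^sup>\<star>"
    using assms p by (simp_all add: mult_assoc)
  show "x \<cdot> (x\<^sup>\<star> \<cdot> (x \<cdot> z)) = x \<cdot> z" if "z \<in> carrier S"
    using arg_cong[OF p(2), of "\<lambda>y. y \<cdot> z"] assms p(1) that by (simp add: mult_assoc mult_closed)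
  show "x\<^sup>\<star> \<cdot> (x \<cdot> (x\<^sup>\<star> \<cdot> z)) = x\<^sup>\<star> \<cdot> z" if "z \<in> carrier S"
    using arg_cong[OF p(3), of "\<lambda>y. y \<cdot> z"] assms p(1) that by (simp add: mult_assoc mult_closed)
qed

lemmas inv_simps = mult_closed mult_assoc sinv_props(1) sinv_cancel

lemma sinv_idem: "e \<in> idems S \<Longrightarrow> e\<^sup>\<star> = e"
  by (intro sinv_eqI) (auto simp: idems_def)

lemma sinv_sinv: "x \<in> carrier S \<Longrightarrow> x\<^sup>\<star>\<^sup>\<star> = x"
  by (intro sinv_eqI) (simp_all add: sinv_props)

lemma idem_range_dom:
  "x \<in> carrier S \<Longrightarrow> x \<cdot> x\<^sup>\<star> \<in> idems S" "x \<in> carrier S \<Longrightarrow> x\<^sup>\<star> \<cdot> x \<in> idems S"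
  by (simp_all add: idems_def inv_simps)

lemma sinv_mult:
  assumes [simp]: "x \<in> carrier S" "y \<in> carrier S"
  shows "(x \<cdot> y)\<^sup>\<star> = y\<^sup>\<star> \<cdot> x\<^sup>\<star>"
proof (rule sinv_eqI)
  note [simp] = inv_simps
  \<comment> \<open>Swapping the two inner idempotents puts x^-1 x next to x and y y^-1 next to y,
    where they are absorbed.\<close>
  have c: "(x\<^sup>\<star> \<cdot> x) \<cdot> (y \<cdot> y\<^sup>\<star>) = (y \<cdot> y\<^sup>\<star>) \<cdot> (x\<^sup>\<star> \<cdot> x)"
    by (intro idems_commute idem_range_dom) simp_all
  have "x \<cdot> y \<cdot> (y\<^sup>\<star> \<cdot> x\<^sup>\<star>) \<cdot> (x \<cdot> y) = x \<cdot> ((y \<cdot> y\<^sup>\<star>) \<cdot> (x\<^sup>\<star> \<cdot> x)) \<cdot> y" by simp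
  also have "\<dots> = x \<cdot> y" unfolding c[symmetric] by simp
  finally show "x \<cdot> y \<cdot> (y\<^sup>\<star> \<cdot> x\<^sup>\<star>) \<cdot> (x \<cdot> y) = x \<cdot> y" .
  have "y\<^sup>\<star> \<cdot> x\<^sup>\<star> \<cdot> (x \<cdot> y) \<cdot> (y\<^sup>\<star> \<cdot> x\<^sup>\<star>) = y\<^sup>\<star> \<cdot> ((x\<^sup>\<star> \<cdot> x) \<cdot> (y \<cdot> y\<^sup>\<star>)) \<cdot> x\<^sup>\<star>" by simp
  also have "\<dots> = y\<^sup>\<star> \<cdot> x\<^sup>\<star>" unfolding c by simp
  finally show "y\<^sup>\<star> \<cdot> x\<^sup>\<star> \<cdot> (x \<cdot> y) \<cdot> (y\<^sup>\<star> \<cdot> x\<^sup>\<star>) = y\<^sup>\<star> \<cdot> x\<^sup>\<star>" .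
qed (simp_all add: inv_simps)

text \<open>An idempotent can pass from the right of x to its left at the cost of conjugation. This
  makes the natural order two-sided although \<open>nat_le\<close> multiplies on the left
  only.\<close>

lemma conj_idem:
  assumes "x \<in> carrier S" and e: "e \<in> idems S"
  shows "x \<cdot> e \<cdot> x\<^sup>\<star> \<in> idems S" and "x \<cdot> e = (x \<cdot> e \<cdot> x\<^sup>\<star>) \<cdot> x"
proof -
  note [simp] = inv_simps assms(1) idems_carrier[OF e]
  have c: "(x\<^sup>\<star> \<cdot> x) \<cdot> e = e \<cdot> (x\<^sup>\<star> \<cdot> x)"
    by (intro idems_commute idem_range_dom) (simp_all add: e)
  have "(x \<cdot> e \<cdot> x\<^sup>\<star>) \<cdot> x = x \<cdot> (e \<cdot> (x\<^sup>\<star> \<cdot> x))" by simp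
  also have "\<dots> = x \<cdot> e" unfolding c[symmetric] by simp
  finally show *: "x \<cdot> e = (x \<cdot> e \<cdot> x\<^sup>\<star>) \<cdot> x" by simp
  have "(x \<cdot> e \<cdot> x\<^sup>\<star>) \<cdot> (x \<cdot> e \<cdot> x\<^sup>\<star>) = ((x \<cdot> e \<cdot> x\<^sup>\<star>) \<cdot> x) \<cdot> e \<cdot> x\<^sup>\<star>" by simp
  also have "\<dots> = x \<cdot> (e \<cdot> e) \<cdot> x\<^sup>\<star>" by (subst *[symmetric]) simp
  also have "e \<cdot> e = e" using e by (simp add: idems_def)
  finally show "x \<cdot> e \<cdot> x\<^sup>\<star> \<in> idems S" by (simp add: idems_def)
qed

lemma nat_le_carrier: "nat_le S s t \<Longrightarrow> s \<in> carrier S" "nat_le S s t \<Longrightarrow> t \<in> carrier S"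
  by (simp_all add: nat_le_def)

lemma nat_le_left: "\<lbrakk>e \<in> idems S; t \<in> carrier S\<rbrakk> \<Longrightarrow> nat_le S (e \<cdot> t) t"
  by (auto simp: nat_le_def mult_closed idems_carrier)

lemma nat_le_right: "\<lbrakk>e \<in> idems S; t \<in> carrier S\<rbrakk> \<Longrightarrow> nat_le S (t \<cdot> e) t"
  using conj_idem[of t e] nat_le_left by metis

lemma nat_le_refl: "s \<in> carrier S \<Longrightarrow> nat_le S s s"
  using nat_le_left[of "s \<cdot> s\<^sup>\<star>" s] by (simp add: idem_range_dom sinv_props)

text \<open>Any idempotent that witnesses s \<le> t can be replaced by the canonical one, the range
  idempotent of s, since idempotents commute.\<close>

lemma nat_le_eq_left:
  assumes "nat_le S s t" shows "s = (s \<cdot> s\<^sup>\<star>) \<cdot> t"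
proof -
  obtain e where e: "e \<in> idems S" "s = e \<cdot> t" and t: "t \<in> carrier S"
    using assms by (auto simp: nat_le_def)
  note [simp] = inv_simps t idems_carrier[OF e(1)]
  have c: "(t \<cdot> t\<^sup>\<star>) \<cdot> e = e \<cdot> (t \<cdot> t\<^sup>\<star>)"
    by (intro idems_commute idem_range_dom) (simp_all add: e)
  have "(s \<cdot> s\<^sup>\<star>) \<cdot> t = e \<cdot> ((t \<cdot> t\<^sup>\<star>) \<cdot> e) \<cdot> t"
    by (simp add: e sinv_mult sinv_idem)
  also have "\<dots> = (e \<cdot> e) \<cdot> t" unfolding c by simp
  also have "\<dots> = s" using e by (simp add: idems_def)
  finally show ?thesis by simp
qed

lemma nat_le_sinv:
  assumes "nat_le S s t" shows "nat_le S (s\<^sup>\<star>) (t\<^sup>\<star>)"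
proof -
  obtain e where e: "e \<in> idems S" "s = e \<cdot> t" and t: "t \<in> carrier S"
    using assms by (auto simp: nat_le_def)
  then have "s\<^sup>\<star> = t\<^sup>\<star> \<cdot> e" by (simp add: sinv_mult sinv_idem idems_carrier)
  then show ?thesis using nat_le_right e t sinv_props by simp
qed

lemma nat_le_eq_right:
  assumes "nat_le S s t" shows "s = t \<cdot> (s\<^sup>\<star> \<cdot> s)"
proof -
  have c: "s \<in> carrier S" "t \<in> carrier S" using nat_le_carrier[OF assms] by auto
  have "s\<^sup>\<star>\<^sup>\<star> = ((s\<^sup>\<star> \<cdot> s\<^sup>\<star>\<^sup>\<star>) \<cdot> t\<^sup>\<star>)\<^sup>\<star>"
    using nat_le_eq_left[OF nat_le_sinv[OF assms]] by simp
  then show ?thesis using c by (simp add: sinv_sinv sinv_mult inv_simps)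
qed

lemma nat_le_trans:
  assumes "nat_le S s t" "nat_le S t u" shows "nat_le S s u"
proof -
  obtain e f where "e \<in> idems S" "f \<in> idems S" "s = e \<cdot> t" "t = f \<cdot> u"
    using assms by (auto simp: nat_le_def)
  moreover from this nat_le_carrier[OF assms(2)] have "s = (e \<cdot> f) \<cdot> u"
    by (simp add: mult_assoc idems_carrier)
  ultimately show ?thesis
    using nat_le_left[OF idems_mult_closed] nat_le_carrier[OF assms(2)] by metis
qed

lemma nat_le_mult:
  assumes "nat_le S s s'" "nat_le S t t'" shows "nat_le S (s \<cdot> t) (s' \<cdot> t')"
proof -
  obtain e where e: "e \<in> idems S" "s = e \<cdot> s'" using assms(1) by (auto simp: nat_le_def)
  have t: "t = t' \<cdot> (t\<^sup>\<star> \<cdot> t)" by (rule nat_le_eq_right[OF assms(2)])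
  have i: "t\<^sup>\<star> \<cdot> t \<in> idems S" by (intro idem_range_dom nat_le_carrier[OF assms(2)])
  note c = nat_le_carrier[OF assms(1)] nat_le_carrier[OF assms(2)] idems_carrier[OF i]
    idems_carrier[OF e(1)]
  have "s \<cdot> t = (e \<cdot> s') \<cdot> (t' \<cdot> (t\<^sup>\<star> \<cdot> t))" using e(2) t by simp
  also have "\<dots> = e \<cdot> ((s' \<cdot> t') \<cdot> (t\<^sup>\<star> \<cdot> t))" using c by (simp add: mult_closed mult_assoc)
  finally have "s \<cdot> t = e \<cdot> ((s' \<cdot> t') \<cdot> (t\<^sup>\<star> \<cdot> t))" .
  moreover have "nat_le S \<dots> ((s' \<cdot> t') \<cdot> (t\<^sup>\<star> \<cdot> t))"
    using c e by (intro nat_le_left) (simp_all add: mult_closed)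
  moreover have "nat_le S ((s' \<cdot> t') \<cdot> (t\<^sup>\<star> \<cdot> t)) (s' \<cdot> t')"
    using c i by (intro nat_le_right) (simp_all add: mult_closed)
  ultimately show ?thesis using nat_le_trans by metis
qed

lemma nat_le_antisym:
  assumes "nat_le S s t" "nat_le S t s" shows "s = t"
proof -
  obtain e f where ef: "e \<in> idems S" "f \<in> idems S" "s = e \<cdot> t" "t = f \<cdot> s"
    using assms by (auto simp: nat_le_def)
  note [simp] = nat_le_carrier[OF assms(1)] idems_carrier[OF ef(1)] idems_carrier[OF ef(2)]
  have "f \<cdot> (f \<cdot> s) = f \<cdot> s" using ef(2) by (simp add: idems_def flip: mult_assoc)
  then have ft: "f \<cdot> t = t" by (simp flip: ef(4))
  have "t = f \<cdot> (e \<cdot> t)" by (simp flip: ef(3,4))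
  also have "\<dots> = (f \<cdot> e) \<cdot> t" by (simp add: mult_assoc)
  also have "\<dots> = (e \<cdot> f) \<cdot> t" using idems_commute[OF ef(1,2)] by simp
  also have "\<dots> = e \<cdot> t" by (simp add: mult_assoc ft)
  finally show ?thesis by (simp flip: ef(3))
qed

lemma nat_le_idem: "\<lbrakk>nat_le S s e; e \<in> idems S\<rbrakk> \<Longrightarrow> s \<in> idems S"
  unfolding nat_le_def using idems_mult_closed by auto

text \<open>Restricting s to an idempotent inside its domain gives that idempotent as the new
  domain. This supplies the restricted elements that make the domains of the action
  down-closed.\<close>

lemma restrict_dom:
  assumes "s \<in> carrier S" "e \<in> idems S" "nat_le S e (s\<^sup>\<star> \<cdot> s)"
  shows "(s \<cdot> e)\<^sup>\<star> \<cdot> (s \<cdot> e) = e"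
proof -
  note c = assms(1) idems_carrier[OF assms(2)]
  have "e \<cdot> (s\<^sup>\<star> \<cdot> s) = e" using assms nat_le_idems idem_range_dom by simp
  then have "e \<cdot> (s\<^sup>\<star> \<cdot> s) \<cdot> e = e" using assms(2) by (simp add: idems_def)
  then show ?thesis using c assms(2) by (simp add: sinv_mult sinv_idem inv_simps)
qed

lemma nat_le_range: "nat_le S s t \<Longrightarrow> nat_le S (s \<cdot> s\<^sup>\<star>) (t \<cdot> t\<^sup>\<star>)"
  by (simp add: nat_le_mult nat_le_sinv)

text \<open>When the range of v is the domain of u, the product composes without loss, as for
  partial bijections with matching range and domain.\<close>

lemma range_mult_eq:
  assumes "u \<in> carrier S" "v \<in> carrier S" "v \<cdot> v\<^sup>\<star> = u\<^sup>\<star> \<cdot> u"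
  shows "(u \<cdot> v) \<cdot> (u \<cdot> v)\<^sup>\<star> = u \<cdot> u\<^sup>\<star>"
proof -
  have "(u \<cdot> v) \<cdot> (u \<cdot> v)\<^sup>\<star> = u \<cdot> (v \<cdot> v\<^sup>\<star>) \<cdot> u\<^sup>\<star>"
    using assms(1,2) by (simp add: sinv_mult inv_simps)
  also have "\<dots> = u \<cdot> u\<^sup>\<star>" unfolding assms(3) using assms(1) by (simp add: inv_simps)
  finally show ?thesis .
qed

lemma dom_mult_eq:
  assumes "u \<in> carrier S" "v \<in> carrier S" "v \<cdot> v\<^sup>\<star> = u\<^sup>\<star> \<cdot> u"
  shows "(u \<cdot> v)\<^sup>\<star> \<cdot> (u \<cdot> v) = v\<^sup>\<star> \<cdot> v"
  using range_mult_eq[of "v\<^sup>\<star>" "u\<^sup>\<star>"] assms by (simp add: sinv_mult sinv_sinv sinv_props)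

text \<open>The only idempotent equals both y y^-1 and y^-1 y for every y, so it is an identity and
  the semigroup inverses are group inverses.\<close>

lemma is_group_if_unique_idem:
  assumes "\<And>e f. \<lbrakk>e \<in> idems S; f \<in> idems S\<rbrakk> \<Longrightarrow> e = f"
  shows "is_group S"
proof -
  obtain x where x: "x \<in> carrier S" using carrier_nonempty by auto
  define u where "u = x\<^sup>\<star> \<cdot> x"
  have u: "u \<in> idems S" unfolding u_def using x by (rule idem_range_dom)
  have *: "y\<^sup>\<star> \<cdot> y = u" "y \<cdot> y\<^sup>\<star> = u" if "y \<in> carrier S" for y
    using that u idem_range_dom assms by auto
  have "group \<lparr>carrier = carrier S, mult = sg_mult S, one = u\<rparr>"
  proof (rule groupI)
    fix y assume "y \<in> carrier \<lparr>carrier = carrier S, mult = sg_mult S, one = u\<rparr>"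
    then have y: "y \<in> carrier S" by simp
    then have "u \<cdot> y = y" using *(2)[OF y] sinv_props(2)[OF y] by simp
    then show "\<one>\<^bsub>\<lparr>carrier = carrier S, mult = sg_mult S, one = u\<rparr>\<^esub>
        \<otimes>\<^bsub>\<lparr>carrier = carrier S, mult = sg_mult S, one = u\<rparr>\<^esub> y = y" by simp
    show "\<exists>z\<in>carrier \<lparr>carrier = carrier S, mult = sg_mult S, one = u\<rparr>.
        z \<otimes>\<^bsub>\<lparr>carrier = carrier S, mult = sg_mult S, one = u\<rparr>\<^esub> y
          = \<one>\<^bsub>\<lparr>carrier = carrier S, mult = sg_mult S, one = u\<rparr>\<^esub>"
      using * y sinv_props(1)[OF y] by auto
  qed (use u in \<open>auto simp: mult_closed mult_assoc idems_carrier\<close>)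
  then show ?thesis unfolding is_group_def by blast
qed

end

lemma is_group_unique_idem:
  assumes "is_group T" "e \<in> idems T" "f \<in> idems T" shows "e = f"
proof -
  obtain u where "group \<lparr>carrier = carrier T, mult = sg_mult T, one = u\<rparr>" (is "group ?G")
    using assms(1) by (auto simp: is_group_def)
  then interpret group ?G .
  have "x = u" if "x \<in> idems T" for x
    using that r_cancel_one[of x x] by (auto simp: idems_def)
  from this[OF assms(2)] this[OF assms(3)] show ?thesis by simp
qed

section \<open>Composition in \<open>\<Sigma>(E)\<close>\<close>

text \<open>A point below a point of the composite's domain is sent by g to something smaller, hence
  still in the down-closed domain of f; ranges are treated dually. The criterion
  \<open>nat_le_Sigma\<close> compares members of the carrier, so closure is needed before the
  premorphism inequality can be read as inclusion of graphs.\<close>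

lemma Sigma_mult_closed:
  assumes f: "f \<in> carrier (Sigma_sl E)" and g: "g \<in> carrier (Sigma_sl E)"
  shows "f \<circ>\<^sub>m g \<in> carrier (Sigma_sl E)"
proof -
  note F = Sigma_carrierD[OF f] and G = Sigma_carrierD[OF g]
  have down: "y \<in> I" if "order_ideal E I" "x \<in> I" "y \<in> carrier E" "y \<sqsubseteq>\<^bsub>E\<^esub> x" for I x y
    using that by (auto simp: order_ideal_def)
  have dom: "y \<in> dom (f \<circ>\<^sub>m g)"
    if x: "x \<in> dom (f \<circ>\<^sub>m g)" and y: "y \<in> carrier E" "y \<sqsubseteq>\<^bsub>E\<^esub> x" for x y
  proof -
    obtain x' where x': "g x = Some x'" "x' \<in> dom f"
      using x by (auto simp: map_comp_Some_iff dom_def)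
    then obtain y' where y': "g y = Some y'" using down[OF G(4) _ y] by auto
    then have "y' \<in> carrier E" "y' \<sqsubseteq>\<^bsub>E\<^esub> x'" using G(2) G(6)[OF y' x'(1)] y(2) by (auto simp: ran_def)
    then have "y' \<in> dom f" using down[OF F(4) x'(2)] by simp
    then show ?thesis using y' by (auto simp: map_comp_Some_iff dom_def)
  qed
  have ran: "y \<in> ran (f \<circ>\<^sub>m g)"
    if x: "x \<in> ran (f \<circ>\<^sub>m g)" and y: "y \<in> carrier E" "y \<sqsubseteq>\<^bsub>E\<^esub> x" for x y
  proof -
    obtain x' where x': "f x' = Some x" "x' \<in> ran g"
      using x by (auto simp: ran_def map_comp_Some_iff)
    moreover from this have "x \<in> ran f" by (auto simp: ran_def)
    ultimately obtain y' where y': "f y' = Some y" using down[OF F(5) _ y] by (auto simp: ran_def)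
    then have "y' \<in> carrier E" "y' \<sqsubseteq>\<^bsub>E\<^esub> x'" using F(1) F(6)[OF y' x'(1)] y(2) by auto
    then have "y' \<in> ran g" using down[OF G(5) x'(2)] by simp
    then show ?thesis using y' by (auto simp: ran_def map_comp_Some_iff)
  qed
  have "dom (f \<circ>\<^sub>m g) \<subseteq> carrier E" "ran (f \<circ>\<^sub>m g) \<subseteq> carrier E"
    using F(2) G(1) by (auto simp: map_comp_Some_iff ran_def dom_def)
  moreover have "inj_on (f \<circ>\<^sub>m g) (dom (f \<circ>\<^sub>m g))"
  proof (rule inj_onI)
    fix x y assume "x \<in> dom (f \<circ>\<^sub>m g)" "y \<in> dom (f \<circ>\<^sub>m g)" "(f \<circ>\<^sub>m g) x = (f \<circ>\<^sub>m g) y"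
    then obtain x' y' z where "g x = Some x'" "g y = Some y'" "f x' = Some z" "f y' = Some z"
      by (auto simp: map_comp_Some_iff)
    then show "x = y" using F(3) G(3) by (metis domI inj_onD)
  qed
  moreover have "x \<sqsubseteq>\<^bsub>E\<^esub> y \<longleftrightarrow> the ((f \<circ>\<^sub>m g) x) \<sqsubseteq>\<^bsub>E\<^esub> the ((f \<circ>\<^sub>m g) y)"
    if "x \<in> dom (f \<circ>\<^sub>m g)" "y \<in> dom (f \<circ>\<^sub>m g)" for x y
    using that F(6) G(6) by (auto simp: map_comp_Some_iff)
  moreover have "order_ideal E (dom (f \<circ>\<^sub>m g))" "order_ideal E (ran (f \<circ>\<^sub>m g))"
    unfolding order_ideal_def using calculation dom ran by blast+
  ultimately show ?thesis by (simp add: Sigma_sl_def sym_inv_monoid_def)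
qed

section \<open>The quotient by an idempotent pure congruence\<close>

locale pure_congruence = inverse_semigroup S for S :: "'a magma" (structure) +
  fixes \<rho> :: "('a \<times> 'a) set"
  assumes cong: "congruence S \<rho>" and pure: "idempotent_pure S \<rho>"
begin

definition cls :: "'a \<Rightarrow> 'a set" where "cls a = \<rho> `` {a}"

abbreviation Q :: "'a set magma" where "Q \<equiv> quot S \<rho>"

lemma equiv_rho: "equiv (carrier S) \<rho>"
  using cong by (simp add: congruence_def)

lemma rho_mult: "\<lbrakk>(s, s') \<in> \<rho>; (t, t') \<in> \<rho>\<rbrakk> \<Longrightarrow> (s \<cdot> t, s' \<cdot> t') \<in> \<rho>"
  using cong by (auto simp: congruence_def)

lemma rho_refl: "s \<in> carrier S \<Longrightarrow> (s, s) \<in> \<rho>"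
  using equiv_rho by (simp add: equiv_def refl_on_def)

lemma rho_sym: "(s, t) \<in> \<rho> \<Longrightarrow> (t, s) \<in> \<rho>"
  using equiv_rho by (auto simp: equiv_def dest: symD)

lemma rho_trans: "\<lbrakk>(s, t) \<in> \<rho>; (t, u) \<in> \<rho>\<rbrakk> \<Longrightarrow> (s, u) \<in> \<rho>"
  using equiv_rho by (auto simp: equiv_def dest: transD)

lemma rho_carrier: "(s, t) \<in> \<rho> \<Longrightarrow> s \<in> carrier S" "(s, t) \<in> \<rho> \<Longrightarrow> t \<in> carrier S"
  using equiv_rho equiv_type by blast+

lemma rho_idem: "\<lbrakk>(e, s) \<in> \<rho>; e \<in> idems S\<rbrakk> \<Longrightarrow> s \<in> idems S"
  using pure by (auto simp: idempotent_pure_def)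

lemma cls_eq_iff: "\<lbrakk>s \<in> carrier S; t \<in> carrier S\<rbrakk> \<Longrightarrow> cls s = cls t \<longleftrightarrow> (s, t) \<in> \<rho>"
  using eq_equiv_class_iff[OF equiv_rho] by (simp add: cls_def)

lemma mem_cls: "t \<in> cls s \<longleftrightarrow> (s, t) \<in> \<rho>"
  by (simp add: cls_def)

lemma cls_self: "s \<in> carrier S \<Longrightarrow> s \<in> cls s"
  by (simp add: mem_cls rho_refl)

lemma carrier_Q: "carrier Q = cls ` carrier S"
  by (auto simp: quot_def quotient_def cls_def)

lemma cls_in_Q: "s \<in> carrier S \<Longrightarrow> cls s \<in> carrier Q"
  by (simp add: carrier_Q)

lemma cls_eqI: "A \<in> carrier Q \<Longrightarrow> a \<in> A \<Longrightarrow> A = cls a"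
  using equiv_class_eq[OF equiv_rho] by (force simp: carrier_Q cls_def)

lemma cls_mult:
  assumes "s \<in> carrier S" "t \<in> carrier S"
  shows "cls s \<cdot>\<^bsub>Q\<^esub> cls t = cls (s \<cdot> t)"
proof -
  \<comment> \<open>The union defining the product in \<open>quot\<close> has the same class as
    every term, and its index sets are nonempty by \<open>cls_self\<close>.\<close>
  have "cls (a \<cdot> b) = cls (s \<cdot> t)" if "a \<in> cls s" "b \<in> cls t" for a b
    using rho_mult[of s a t b] equiv_class_eq[OF equiv_rho] that by (simp add: mem_cls cls_def)
  then have "(\<Union>a\<in>cls s. \<Union>b\<in>cls t. cls (a \<cdot> b)) = (\<Union>a\<in>cls s. \<Union>b\<in>cls t. cls (s \<cdot> t))"
    by (intro SUP_cong refl)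
  also have "\<dots> = cls (s \<cdot> t)" using cls_self assms by blast
  finally show ?thesis by (simp add: quot_def flip: cls_def)
qed

text \<open>Lallement's lemma: with \<open>x\<close> an inverse of \<open>a\<^sup>2\<close>, the element \<open>a x a\<close> is an idempotent
  congruent to \<open>a\<close>.\<close>

lemma rho_square_idem:
  assumes "(a \<cdot> a, a) \<in> \<rho>" shows "a \<in> idems S"
proof -
  have a: "a \<in> carrier S" using assms rho_carrier by blast
  define x where "x = (a \<cdot> a)\<^sup>\<star>"
  have x: "x \<in> carrier S" using a by (simp add: x_def mult_closed sinv_props)
  have p: "x \<cdot> (a \<cdot> a) \<cdot> x = x" "(a \<cdot> a) \<cdot> x \<cdot> (a \<cdot> a) = a \<cdot> a"
    using a by (simp_all add: x_def mult_closed sinv_props)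
  have "(a \<cdot> x \<cdot> a) \<cdot> (a \<cdot> x \<cdot> a) = a \<cdot> (x \<cdot> (a \<cdot> a) \<cdot> x) \<cdot> a"
    using a x by (simp add: mult_closed mult_assoc)
  then have e: "a \<cdot> x \<cdot> a \<in> idems S" using a x by (simp add: p idems_def mult_closed)
  have "((a \<cdot> a) \<cdot> x \<cdot> (a \<cdot> a), a \<cdot> x \<cdot> a) \<in> \<rho>"
    using assms a x by (intro rho_mult) (auto intro: rho_refl)
  then have "(a \<cdot> x \<cdot> a, a) \<in> \<rho>" unfolding p by (blast intro: rho_sym rho_trans assms)
  then show ?thesis using e by (rule rho_idem)
qed

text \<open>If a class squares to itself, any representative a satisfies a a \<rho> a and is then
  itself idempotent by \<open>rho_square_idem\<close>.\<close>

lemma idems_Q: "idems Q = cls ` idems S"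
proof (intro equalityI subsetI)
  fix A assume "A \<in> idems Q"
  then obtain a where a: "a \<in> carrier S" "A = cls a" "A \<cdot>\<^bsub>Q\<^esub> A = A"
    by (auto simp: idems_def carrier_Q)
  then have "(a \<cdot> a, a) \<in> \<rho>" by (simp add: cls_mult cls_eq_iff mult_closed)
  then show "A \<in> cls ` idems S" using rho_square_idem a by blast
qed (auto simp: idems_def cls_mult cls_in_Q)

text \<open>Uniqueness of inverses is hard to see on classes. Existence passes to the quotient at
  once, and commutation of idempotents is inherited from S because every idempotent class has an
  idempotent representative.\<close>

sublocale Q: inverse_semigroup Q
proof (rule inverse_semigroupI)
  show "carrier Q \<noteq> {}" using carrier_nonempty by (simp add: carrier_Q)
  show "x \<cdot>\<^bsub>Q\<^esub> y \<in> carrier Q" if "x \<in> carrier Q" "y \<in> carrier Q" for x y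
    using that by (auto simp: carrier_Q cls_mult mult_closed)
  show "x \<cdot>\<^bsub>Q\<^esub> y \<cdot>\<^bsub>Q\<^esub> z = x \<cdot>\<^bsub>Q\<^esub> (y \<cdot>\<^bsub>Q\<^esub> z)"
    if "x \<in> carrier Q" "y \<in> carrier Q" "z \<in> carrier Q" for x y z
    using that by (auto simp: carrier_Q cls_mult mult_closed mult_assoc)
  show "\<exists>y\<in>carrier Q. x \<cdot>\<^bsub>Q\<^esub> y \<cdot>\<^bsub>Q\<^esub> x = x \<and> y \<cdot>\<^bsub>Q\<^esub> x \<cdot>\<^bsub>Q\<^esub> y = y"
    if x: "x \<in> carrier Q" for x
  proof -
    obtain a where "a \<in> carrier S" "x = cls a" using x by (auto simp: carrier_Q)
    then show ?thesis
      by (intro bexI[of _ "cls (a\<^sup>\<star>)"])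
        (simp_all add: cls_mult sinv_props mult_closed cls_in_Q)
  qed
  show "e \<cdot>\<^bsub>Q\<^esub> f = f \<cdot>\<^bsub>Q\<^esub> e" if "e \<in> idems Q" "f \<in> idems Q" for e f
    using that idems_commute by (auto simp: idems_Q cls_mult idems_carrier)
qed

lemma sinv_cls: "s \<in> carrier S \<Longrightarrow> sinv Q (cls s) = cls (s\<^sup>\<star>)"
  by (intro Q.sinv_eqI) (simp_all add: cls_mult sinv_props mult_closed cls_in_Q)

text \<open>If a \<rho> b, then b a^-1 is related to the idempotent a a^-1, so it is idempotent by
  purity. With equal domains, b = b b^-1 b = (b a^-1) a lies below a; by symmetry and antisymmetry a
  = b.\<close>

lemma rho_eqI:
  assumes "(u, v) \<in> \<rho>" "u\<^sup>\<star> \<cdot> u = v\<^sup>\<star> \<cdot> v" shows "u = v"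
proof -
  have c: "u \<in> carrier S" "v \<in> carrier S" using assms(1) rho_carrier by auto
  have *: "nat_le S b a" if "(a, b) \<in> \<rho>" "b\<^sup>\<star> \<cdot> b = a\<^sup>\<star> \<cdot> a" for a b
  proof -
    note [simp] = rho_carrier[OF that(1)]
    have "(a \<cdot> a\<^sup>\<star>, b \<cdot> a\<^sup>\<star>) \<in> \<rho>" using that by (intro rho_mult rho_refl) (simp_all add: sinv_props)
    then have "b \<cdot> a\<^sup>\<star> \<in> idems S" using rho_idem idem_range_dom by simp
    then have "nat_le S ((b \<cdot> a\<^sup>\<star>) \<cdot> a) a" by (intro nat_le_left) simp_all
    moreover have "(b \<cdot> a\<^sup>\<star>) \<cdot> a = b \<cdot> (b\<^sup>\<star> \<cdot> b)" unfolding that(2) by (simp add: inv_simps)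
    ultimately show ?thesis by (simp add: inv_simps)
  qed
  show ?thesis
    using *[OF assms(1)] *[OF rho_sym[OF assms(1)]] assms(2) by (intro nat_le_antisym) simp_all
qed

section \<open>Group congruences and the comparison with \<sigma>\<close>

lemma rho_sub_sigma: "\<rho> \<subseteq> min_group_cong S"
proof safe
  fix s t assume st: "(s, t) \<in> \<rho>"
  note [simp] = rho_carrier[OF st]
  \<comment> \<open>Purity makes s t^-1 idempotent, so the single element s t^-1 t is a restriction
    of both s and t.\<close>
  have "(t \<cdot> t\<^sup>\<star>, s \<cdot> t\<^sup>\<star>) \<in> \<rho>" using st rho_sym by (intro rho_mult rho_refl) (simp_all add: sinv_props)
  then have "s \<cdot> t\<^sup>\<star> \<in> idems S" using rho_idem idem_range_dom by simp
  then have "nat_le S ((s \<cdot> t\<^sup>\<star>) \<cdot> t) t" by (intro nat_le_left) simp_all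
  moreover have "nat_le S (s \<cdot> (t\<^sup>\<star> \<cdot> t)) s" by (intro nat_le_right idem_range_dom) simp_all
  ultimately show "(s, t) \<in> min_group_cong S"
    unfolding min_group_cong_def by (auto simp: inv_simps)
qed

text \<open>An inverse semigroup is a group exactly when it has one idempotent, and the idempotents
  of the quotient are the classes of idempotents of S.\<close>

lemma group_congruence_iff_idems:
  "group_congruence S \<rho> \<longleftrightarrow> (\<forall>e\<in>idems S. \<forall>f\<in>idems S. (e, f) \<in> \<rho>)"
proof
  assume "group_congruence S \<rho>"
  then have "cls e = cls f" if "e \<in> idems S" "f \<in> idems S" for e f
    using that is_group_unique_idem[of Q] by (simp add: group_congruence_def idems_Q)
  then show "\<forall>e\<in>idems S. \<forall>f\<in>idems S. (e, f) \<in> \<rho>"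
    by (simp add: cls_eq_iff idems_carrier)
next
  assume *: "\<forall>e\<in>idems S. \<forall>f\<in>idems S. (e, f) \<in> \<rho>"
  have "is_group Q"
  proof (rule Q.is_group_if_unique_idem)
    fix A B assume "A \<in> idems Q" "B \<in> idems Q"
    then obtain e f where "e \<in> idems S" "f \<in> idems S" "A = cls e" "B = cls f"
      by (auto simp: idems_Q)
    then show "A = B" using * by (simp add: cls_eq_iff idems_carrier)
  qed
  then show "group_congruence S \<rho>" using cong by (simp add: group_congruence_def)
qed

text \<open>Once all idempotents are related, u \<le> s forces u \<rho> s, because u = (u u^-1) s
  and s = (s s^-1) s; hence \<sigma> is contained in \<rho>. Conversely, \<sigma> relates any two
  idempotents e and f, since e f lies below both.\<close>

lemma group_congruence_iff_sigma:
  "group_congruence S \<rho> \<longleftrightarrow> E_unitary S \<and> \<rho> = min_group_cong S"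
proof
  assume "group_congruence S \<rho>"
  then have *: "(e, f) \<in> \<rho>" if "e \<in> idems S" "f \<in> idems S" for e f
    using that group_congruence_iff_idems by blast
  have below: "(u, s) \<in> \<rho>" if us: "nat_le S u s" for u s
  proof -
    have c: "u \<in> carrier S" "s \<in> carrier S" using nat_le_carrier[OF us] by auto
    have "((u \<cdot> u\<^sup>\<star>) \<cdot> s, (s \<cdot> s\<^sup>\<star>) \<cdot> s) \<in> \<rho>"
      using c by (intro rho_mult * idem_range_dom rho_refl)
    then show ?thesis using nat_le_eq_left[OF us] c by (simp add: sinv_props)
  qed
  have "min_group_cong S \<subseteq> \<rho>"
    unfolding min_group_cong_def using below rho_sym rho_trans by blast
  then have "\<rho> = min_group_cong S" using rho_sub_sigma by blast
  then show "E_unitary S \<and> \<rho> = min_group_cong S" using pure by (simp add: E_unitary_def)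
next
  assume \<rho>: "E_unitary S \<and> \<rho> = min_group_cong S"
  have "(e, f) \<in> min_group_cong S" if "e \<in> idems S" "f \<in> idems S" for e f
    unfolding min_group_cong_def
    using that nat_le_left[of e f] nat_le_right[of f e] by (auto simp: idems_carrier)
  with \<rho> show "group_congruence S \<rho>" unfolding group_congruence_iff_idems by blast
qed

section \<open>The partial action\<close>

definition below :: "'a set \<Rightarrow> 'a set" where
  "below A = {u. \<exists>a\<in>A. nat_le S u a}"

lemma below_carrier: "u \<in> below A \<Longrightarrow> u \<in> carrier S"
  by (auto simp: below_def nat_le_carrier)

lemma below_down: "\<lbrakk>u \<in> below A; nat_le S v u\<rbrakk> \<Longrightarrow> v \<in> below A"
  unfolding below_def using nat_le_trans by blast

lemma below_cls: "s \<in> carrier S \<Longrightarrow> s \<in> below (cls s)"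
  unfolding below_def using cls_self nat_le_refl by blast

lemma below_mult:
  assumes "A \<in> carrier Q" "B \<in> carrier Q" "u \<in> below A" "v \<in> below B"
  shows "u \<cdot> v \<in> below (A \<cdot>\<^bsub>Q\<^esub> B)"
proof -
  obtain a b where ab: "a \<in> A" "b \<in> B" "nat_le S u a" "nat_le S v b"
    using assms by (auto simp: below_def)
  have "A = cls a" "B = cls b" using ab assms cls_eqI by auto
  moreover have "a \<in> carrier S" "b \<in> carrier S" using ab nat_le_carrier by auto
  ultimately have "a \<cdot> b \<in> A \<cdot>\<^bsub>Q\<^esub> B" by (simp add: cls_mult mult_closed cls_self)
  then show ?thesis unfolding below_def using nat_le_mult ab by blast
qed

lemma below_sinv:
  assumes "A \<in> carrier Q" "u \<in> below A"
  shows "u\<^sup>\<star> \<in> below (sinv Q A)"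
proof -
  obtain a where a: "a \<in> A" "nat_le S u a" using assms by (auto simp: below_def)
  have "A = cls a" "a \<in> carrier S" using a assms cls_eqI nat_le_carrier by auto
  then have "a\<^sup>\<star> \<in> sinv Q A" by (simp add: sinv_cls cls_self sinv_props)
  then show ?thesis unfolding below_def using nat_le_sinv a by blast
qed

text \<open>Let e be the common domain. Then u = a e and v = b e for related a and b, so u \<rho> v
  and \<open>rho_eqI\<close> applies. This is what makes the action single-valued.\<close>

lemma below_inj:
  assumes A: "A \<in> carrier Q" and "u \<in> below A" "v \<in> below A" "u\<^sup>\<star> \<cdot> u = v\<^sup>\<star> \<cdot> v"
  shows "u = v"
proof (rule rho_eqI)
  obtain a b where ab: "a \<in> A" "b \<in> A" "nat_le S u a" "nat_le S v b"
    using assms by (auto simp: below_def)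
  have c: "a \<in> carrier S" "b \<in> carrier S" "v \<in> carrier S" using ab nat_le_carrier by auto
  have "(a, b) \<in> \<rho>" using A ab cls_eqI[of A] c cls_eq_iff by metis
  then have "(a \<cdot> (u\<^sup>\<star> \<cdot> u), b \<cdot> (v\<^sup>\<star> \<cdot> v)) \<in> \<rho>"
    unfolding assms(4) using c by (intro rho_mult rho_refl) (simp_all add: inv_simps)
  then show "(u, v) \<in> \<rho>"
    using nat_le_eq_right[OF ab(3)] nat_le_eq_right[OF ab(4)] by simp
qed fact

text \<open>Measures how far u may be from lying in A: only by the factor [u u^-1], which disappears
  when it equals A A^-1.\<close>

lemma below_cls_mult:
  assumes "A \<in> carrier Q" "u \<in> below A" shows "cls u = cls (u \<cdot> u\<^sup>\<star>) \<cdot>\<^bsub>Q\<^esub> A"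
proof -
  obtain a where a: "a \<in> A" "nat_le S u a" using assms by (auto simp: below_def)
  have "A = cls a" using a assms cls_eqI by simp
  then show ?thesis using nat_le_eq_left[OF a(2)] nat_le_carrier[OF a(2)]
    by (simp add: cls_mult inv_simps)
qed

text \<open>For x = u^-1 u the value u u^-1 is the conjugate u x u^-1. The definite description
  picks a unique element when A is a class, by \<open>below_inj\<close>.\<close>

definition act :: "'a set \<Rightarrow> 'a \<rightharpoonup> 'a" where
  "act A x = (if \<exists>u\<in>below A. u\<^sup>\<star> \<cdot> u = x
     then Some (let u = THE u. u \<in> below A \<and> u\<^sup>\<star> \<cdot> u = x in u \<cdot> u\<^sup>\<star>) else None)"

text \<open>This description of the graph treats domain and range alike: replacing u by u^-1 swaps x
  and y, so facts about ranges become facts about the action of the inverse class.\<close>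

lemma act_eq_Some:
  assumes A: "A \<in> carrier Q"
  shows "act A x = Some y \<longleftrightarrow> (\<exists>u\<in>below A. x = u\<^sup>\<star> \<cdot> u \<and> y = u \<cdot> u\<^sup>\<star>)"
proof -
  have act: "act A (u\<^sup>\<star> \<cdot> u) = Some (u \<cdot> u\<^sup>\<star>)" if u: "u \<in> below A" for u
  proof -
    have "(THE v. v \<in> below A \<and> v\<^sup>\<star> \<cdot> v = u\<^sup>\<star> \<cdot> u) = u"
      using u below_inj[OF A] by (intro the_equality) auto
    then show ?thesis using u by (auto simp: act_def)
  qed
  show ?thesis
  proof
    assume y: "act A x = Some y"
    then obtain u where "u \<in> below A" "x = u\<^sup>\<star> \<cdot> u" by (auto simp: act_def split: if_splits)
    with y act show "\<exists>u\<in>below A. x = u\<^sup>\<star> \<cdot> u \<and> y = u \<cdot> u\<^sup>\<star>" by auto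
  qed (use act in auto)
qed

lemma act_below_idem:
  assumes "A \<in> carrier Q" "e \<in> idems S" "e \<in> below A"
  shows "act A e = Some e"
proof -
  have "e\<^sup>\<star> \<cdot> e = e" "e \<cdot> e\<^sup>\<star> = e"
    using assms(2) by (simp_all add: sinv_idem) (simp_all add: idems_def)
  then show ?thesis using assms by (metis act_eq_Some)
qed

lemma act_sinv:
  assumes A: "A \<in> carrier Q"
  shows "act (sinv Q A) y = Some x \<longleftrightarrow> act A x = Some y"
proof -
  have *: "act (sinv Q B) y = Some x" if B: "B \<in> carrier Q" "act B x = Some y" for B x y
  proof -
    obtain u where u: "u \<in> below B" "x = u\<^sup>\<star> \<cdot> u" "y = u \<cdot> u\<^sup>\<star>"
      using B act_eq_Some by auto
    then show ?thesis
      using below_sinv[OF B(1) u(1)] below_carrier[OF u(1)] Q.sinv_props(1)[OF B(1)]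
      by (auto simp: act_eq_Some sinv_sinv intro!: bexI[of _ "u\<^sup>\<star>"])
  qed
  \<comment> \<open>Inverting twice returns A, so the one implication, applied to A and to its
    inverse, gives both directions.\<close>
  show ?thesis using *[of A] *[of "sinv Q A"] A Q.sinv_props(1) Q.sinv_sinv by metis
qed

lemma act_inj: "\<lbrakk>A \<in> carrier Q; act A x = Some y; act A x' = Some y\<rbrakk> \<Longrightarrow> x = x'"
  using act_sinv by (metis option.inject)

lemma pinv_act: "A \<in> carrier Q \<Longrightarrow> pinv (act A) = act (sinv Q A)"
proof
  fix y assume A: "A \<in> carrier Q"
  have "inj_on (act A) (dom (act A))" by (rule inj_onI) (auto intro: act_inj[OF A])
  then have "pinv (act A) y = Some x \<longleftrightarrow> act (sinv Q A) y = Some x" for x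
    by (simp add: pinv_eq_Some act_sinv A)
  then show "pinv (act A) y = act (sinv Q A) y" by (metis not_Some_eq)
qed

lemma act_idems:
  assumes "A \<in> carrier Q" "act A x = Some y" shows "x \<in> idems S" "y \<in> idems S"
  using assms by (auto simp: act_eq_Some intro!: idem_range_dom below_carrier)

text \<open>If u carries y to its image, the restriction u x still lies below A and carries x to
  something smaller.\<close>

lemma act_le:
  assumes A: "A \<in> carrier Q" and y: "act A y = Some y'"
    and x: "x \<in> idems S" and le: "nat_le S x y"
  obtains x' where "act A x = Some x'" "nat_le S x' y'"
proof -
  obtain u where u: "u \<in> below A" "y = u\<^sup>\<star> \<cdot> u" "y' = u \<cdot> u\<^sup>\<star>"
    using A y act_eq_Some by auto
  let ?v = "u \<cdot> x"
  have v: "nat_le S ?v u" by (rule nat_le_right[OF x below_carrier[OF u(1)]])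
  have "act A x = Some (?v \<cdot> ?v\<^sup>\<star>)"
    using below_down[OF u(1) v] restrict_dom[OF below_carrier[OF u(1)] x] le u(2)
    by (auto simp: act_eq_Some[OF A] intro!: bexI[of _ ?v])
  then show ?thesis using that nat_le_range[OF v] u(3) by simp
qed

abbreviation E :: "'a gorder" where "E \<equiv> idem_semilattice S"

lemma E_simps: "carrier E = idems S" "le E = nat_le S"
  by (simp_all add: idem_semilattice_def)

lemma act_order_ideal:
  assumes "A \<in> carrier Q" shows "order_ideal E (dom (act A))"
  unfolding order_ideal_def E_simps using act_idems[OF assms] act_le[OF assms] by blast

text \<open>The range is the domain of the inverse class's action, and order reflection is
  monotonicity of that action, so the one-directional \<open>act_le\<close> suffices.\<close>

lemma act_in_Sigma:
  assumes A: "A \<in> carrier Q" shows "act A \<in> carrier (Sigma_sl E)"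
proof -
  have ran: "ran (act A) = dom (act (sinv Q A))"
    by (auto simp: ran_def dom_def act_sinv A)
  have mono: "nat_le S x' y'" if "nat_le S x y" "B \<in> carrier Q" "act B x = Some x'" "act B y = Some y'"
    for B x y x' y'
    using act_le[OF that(2,4) _ that(1)] act_idems[OF that(2,3)] that(3) by (metis option.inject)
  have iso: "nat_le S x y \<longleftrightarrow> nat_le S x' y'" if "act A x = Some x'" "act A y = Some y'" for x y x' y'
    using mono[OF _ A that] mono[OF _ Q.sinv_props(1)[OF A], of x' y' x y] that act_sinv[OF A]
    by metis
  have "inj_on (act A) (dom (act A))" by (rule inj_onI) (auto intro: act_inj[OF A])
  moreover have "order_ideal E (ran (act A))"
    unfolding ran by (rule act_order_ideal[OF Q.sinv_props(1)[OF A]])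
  moreover have "dom (act A) \<subseteq> idems S" "ran (act A) \<subseteq> idems S"
    using act_idems[OF A] by (auto simp: ran_def)
  moreover have "nat_le S x y \<longleftrightarrow> nat_le S (the (act A x)) (the (act A y))"
    if "x \<in> dom (act A)" "y \<in> dom (act A)" for x y
    using that iso by auto
  ultimately show ?thesis
    by (simp add: Sigma_sl_def sym_inv_monoid_def act_order_ideal[OF A] E_simps)
qed

text \<open>If v carries x to y and u carries y to z, their range and domain match, so u v carries x
  to z and lies below AB. The inclusion can be proper, as an element below AB need not factor in
  this way.\<close>

lemma act_mult_le:
  assumes A: "A \<in> carrier Q" and B: "B \<in> carrier Q"
  shows "act A \<circ>\<^sub>m act B \<subseteq>\<^sub>m act (A \<cdot>\<^bsub>Q\<^esub> B)"
proof -
  have "act (A \<cdot>\<^bsub>Q\<^esub> B) x = Some z" if xy: "act B x = Some y" and yz: "act A y = Some z" for x y z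
  proof -
    obtain u v where u: "u \<in> below A" "y = u\<^sup>\<star> \<cdot> u" "z = u \<cdot> u\<^sup>\<star>"
      and v: "v \<in> below B" "x = v\<^sup>\<star> \<cdot> v" "y = v \<cdot> v\<^sup>\<star>"
      using xy yz A B act_eq_Some by auto
    then have eq: "v \<cdot> v\<^sup>\<star> = u\<^sup>\<star> \<cdot> u" by simp
    show ?thesis
      using below_mult[OF A B u(1) v(1)] dom_mult_eq[OF _ _ eq] range_mult_eq[OF _ _ eq]
        u v below_carrier Q.mult_closed[OF A B]
      by (auto simp: act_eq_Some intro!: bexI[of _ "u \<cdot> v"])
  qed
  then show ?thesis by (fastforce simp: map_le_def map_comp_Some_iff)
qed

section \<open>Premorphism property and strictness\<close>

lemma partial_action_act: "partial_action Q E act"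
proof -
  have "nat_le (Sigma_sl E) (act A \<cdot>\<^bsub>Sigma_sl E\<^esub> act B) (act (A \<cdot>\<^bsub>Q\<^esub> B))"
    if A: "A \<in> carrier Q" and B: "B \<in> carrier Q" for A B
  proof -
    have "act A \<circ>\<^sub>m act B \<in> carrier (Sigma_sl E)"
      by (intro Sigma_mult_closed act_in_Sigma A B)
    then show ?thesis
      using act_mult_le[OF A B] act_in_Sigma[OF Q.mult_closed[OF A B]] by (simp add: nat_le_Sigma)
  qed
  then show ?thesis
    unfolding partial_action_def premorphism_def
    using act_in_Sigma Q.inverse_semigroup_axioms lower_semilattice_idem_semilattice
    by (simp add: sinv_Sigma pinv_act)
qed

text \<open>Suppose the class of an idempotent f acts at e through u. By purity all members of [f]
  are idempotent, so u is idempotent too, and its domain e is u itself. Thus e lies below a member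
  of [f], which gives [e] \<le> [f].\<close>

lemma least_dom_idems:
  assumes e: "e \<in> idems S"
  shows "least (idem_semilattice Q) (cls e) (dom_idems Q act e)"
proof -
  have le: "nat_le Q (cls e) (cls f)" if f: "f \<in> idems S" "e \<in> dom (act (cls f))" for f
  proof -
    obtain u where u: "u \<in> below (cls f)" "e = u\<^sup>\<star> \<cdot> u"
      using f(2) act_eq_Some[OF cls_in_Q[OF idems_carrier[OF f(1)]]] by auto
    obtain a where a: "(f, a) \<in> \<rho>" "nat_le S u a" using u(1) by (auto simp: below_def mem_cls)
    have "u \<in> idems S" using nat_le_idem[OF a(2) rho_idem[OF a(1) f(1)]] .
    then have "u = e" using u(2) by (simp add: sinv_idem idems_def)
    then obtain g where g: "g \<in> idems S" "e = g \<cdot> a" using a(2) by (auto simp: nat_le_def)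
    then have "cls e = cls g \<cdot>\<^bsub>Q\<^esub> cls f"
      using a(1) rho_carrier[OF a(1)] cls_eq_iff[of f a] by (simp add: cls_mult idems_carrier)
    then show ?thesis using Q.nat_le_left[of "cls g" "cls f"] g f by (simp add: idems_Q cls_in_Q idems_carrier)
  qed
  have "e \<in> dom (act (cls e))"
    using act_below_idem[of "cls e" e] e below_cls by (simp add: idems_carrier cls_in_Q domIff)
  then show ?thesis
    using e le by (auto simp: least_def Upper_def dom_idems_def idem_semilattice_def idems_Q)
qed

lemma strict_alpha_act: "e \<in> idems S \<Longrightarrow> strict_alpha Q act e = cls e"
  unfolding strict_alpha_def
  by (rule the_equality, erule least_dom_idems)
    (rule partial_order.least_unique[OF lower_semilattice.axioms(1)[OF
        Q.lower_semilattice_idem_semilattice] _ least_dom_idems])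

text \<open>Since \<alpha> is the quotient map restricted to idempotents, preservation of meets is
  multiplicativity of \<open>cls\<close>.\<close>

lemma strict_partial_action_act: "strict_partial_action Q E act"
  unfolding strict_partial_action_def E_simps
  using partial_action_act least_dom_idems
  by (auto simp: meet_idem_semilattice Q.meet_idem_semilattice strict_alpha_act idems_mult_closed
      idems_Q cls_mult idems_carrier)

section \<open>The embedding and its image\<close>

definition emb :: "'a \<Rightarrow> 'a \<times> 'a set" where
  "emb s = (s \<cdot> s\<^sup>\<star>, cls s)"

lemma act_dom_range: "u \<in> carrier S \<Longrightarrow> act (cls u) (u\<^sup>\<star> \<cdot> u) = Some (u \<cdot> u\<^sup>\<star>)"
  using below_cls by (auto simp: act_eq_Some cls_in_Q)

lemma semidirect_carrier:
  "carrier (semidirect E act Q) = {(e, A). A \<in> carrier Q \<and> e \<in> ran (act A)}"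
  using act_idems by (auto simp: semidirect_def E_simps ran_def)

lemma semidirect_m_carrier:
  "carrier (semidirect_m E act Q) = {(e, A). A \<in> carrier Q \<and> e \<in> ran (act A) \<and> cls e = A \<cdot>\<^bsub>Q\<^esub> sinv Q A}"
proof -
  have "e \<in> idems S" if "A \<in> carrier Q" "e \<in> ran (act A)" for e A
    using that act_idems by (auto simp: ran_def)
  then show ?thesis
    by (auto simp: semidirect_m_def semidirect_carrier strict_alpha_act)
qed

lemma emb_image: "emb ` carrier S = carrier (semidirect_m E act Q)"
proof (intro equalityI subsetI)
  fix p assume "p \<in> emb ` carrier S"
  then obtain s where s: "s \<in> carrier S" "p = emb s" by auto
  then have "s \<cdot> s\<^sup>\<star> \<in> ran (act (cls s))" using act_dom_range by (auto simp: ran_def)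
  then show "p \<in> carrier (semidirect_m E act Q)"
    using s by (simp add: semidirect_m_carrier emb_def cls_in_Q sinv_cls cls_mult sinv_props)
next
  fix p assume "p \<in> carrier (semidirect_m E act Q)"
  then obtain e A where p: "p = (e, A)" and A: "A \<in> carrier Q" "e \<in> ran (act A)"
    and eq: "cls e = A \<cdot>\<^bsub>Q\<^esub> sinv Q A" by (auto simp: semidirect_m_carrier)
  obtain u where u: "u \<in> below A" "e = u \<cdot> u\<^sup>\<star>"
    using A by (auto simp: ran_def act_eq_Some)
  \<comment> \<open>So far u is only below A. The strictness equation turns [u] = [e] A into A A^-1
    A = A, so \<open>emb u\<close> is the given pair.\<close>
  have "cls u = A" using below_cls_mult[OF A(1) u(1)] eq u(2) Q.sinv_props(2)[OF A(1)] by simp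
  then show "p \<in> emb ` carrier S" using u below_carrier p by (auto simp: emb_def)
qed

lemma emb_inj: "inj_on emb (carrier S)"
proof (rule inj_onI)
  fix s t assume [simp]: "s \<in> carrier S" "t \<in> carrier S" and eq: "emb s = emb t"
  \<comment> \<open>The first coordinates record ranges while \<open>below_inj\<close> compares
    domains, so it is applied to the inverses, which both lie in the inverse of the common
    class.\<close>
  have "s\<^sup>\<star> = t\<^sup>\<star>"
  proof (rule below_inj)
    show "sinv Q (cls s) \<in> carrier Q" by (simp add: Q.sinv_props cls_in_Q)
    show "s\<^sup>\<star> \<in> below (sinv Q (cls s))" "t\<^sup>\<star> \<in> below (sinv Q (cls s))"
      using eq below_cls[of "s\<^sup>\<star>"] below_cls[of "t\<^sup>\<star>"]
      by (simp_all add: sinv_props emb_def flip: sinv_cls)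
    show "s\<^sup>\<star>\<^sup>\<star> \<cdot> s\<^sup>\<star> = t\<^sup>\<star>\<^sup>\<star> \<cdot> t\<^sup>\<star>" using eq by (simp add: sinv_sinv emb_def)
  qed
  then have "s\<^sup>\<star>\<^sup>\<star> = t\<^sup>\<star>\<^sup>\<star>" by (rule arg_cong)
  then show "s = t" by (simp add: sinv_sinv)
qed

lemma emb_mult:
  assumes [simp]: "s \<in> carrier S" "t \<in> carrier S"
  shows "emb s \<cdot>\<^bsub>semidirect E act Q\<^esub> emb t = emb (s \<cdot> t)"
proof -
  note [simp] = inv_simps
  \<comment> \<open>The first coordinate of the product is the image of s^-1 s t t^-1 under the
    action of [s]. The element realising this is s restricted to the range of t: it has that domain,
    and its range is that of s t.\<close>
  let ?u = "s \<cdot> (t \<cdot> t\<^sup>\<star>)"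
  have i: "t \<cdot> t\<^sup>\<star> \<in> idems S" "s\<^sup>\<star> \<cdot> s \<in> idems S" by (intro idem_range_dom assms)+
  have inv: "act (sinv Q (cls s)) (s \<cdot> s\<^sup>\<star>) = Some (s\<^sup>\<star> \<cdot> s)"
    by (simp add: act_sinv cls_in_Q act_dom_range)
  have u: "?u \<in> below (cls s)"
    by (rule below_down[OF below_cls nat_le_right]) (simp_all add: i)
  have "?u\<^sup>\<star> \<cdot> ?u = (t \<cdot> t\<^sup>\<star>) \<cdot> ((s\<^sup>\<star> \<cdot> s) \<cdot> (t \<cdot> t\<^sup>\<star>))"
    by (simp add: sinv_mult sinv_sinv)
  also have "(s\<^sup>\<star> \<cdot> s) \<cdot> (t \<cdot> t\<^sup>\<star>) = (t \<cdot> t\<^sup>\<star>) \<cdot> (s\<^sup>\<star> \<cdot> s)"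
    by (rule idems_commute) (simp_all only: i)
  also have "(t \<cdot> t\<^sup>\<star>) \<cdot> ((t \<cdot> t\<^sup>\<star>) \<cdot> (s\<^sup>\<star> \<cdot> s)) = (t \<cdot> t\<^sup>\<star>) \<cdot> (s\<^sup>\<star> \<cdot> s)" by simp
  also have "\<dots> = (s\<^sup>\<star> \<cdot> s) \<cdot> (t \<cdot> t\<^sup>\<star>)"
    by (rule idems_commute) (simp_all only: i)
  finally have dom: "(s\<^sup>\<star> \<cdot> s) \<cdot> (t \<cdot> t\<^sup>\<star>) = ?u\<^sup>\<star> \<cdot> ?u" by simp
  have ran: "(s \<cdot> t) \<cdot> (s \<cdot> t)\<^sup>\<star> = ?u \<cdot> ?u\<^sup>\<star>" by (simp add: sinv_mult sinv_sinv)
  have "act (cls s) ((s\<^sup>\<star> \<cdot> s) \<cdot> (t \<cdot> t\<^sup>\<star>)) = Some ((s \<cdot> t) \<cdot> (s \<cdot> t)\<^sup>\<star>)"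
    unfolding act_eq_Some[OF cls_in_Q[OF assms(1)]] using u dom ran by blast
  then show ?thesis
    using inv
    by (simp del: mult_assoc add: semidirect_def emb_def pinv_act cls_in_Q meet_idem_semilattice i cls_mult)
qed

lemma emb_hom: "emb \<in> sg_hom S (semidirect E act Q)"
proof -
  have "carrier (semidirect_m E act Q) \<subseteq> carrier (semidirect E act Q)"
    by (auto simp: semidirect_m_def)
  then show ?thesis using emb_mult emb_image by (auto simp: sg_hom_def)
qed

lemma snd_semidirect_m: "snd ` carrier (semidirect_m E act Q) = carrier Q"
  unfolding emb_image[symmetric] by (simp add: image_image emb_def carrier_Q)

lemma snd_hom: "snd \<in> sg_hom (semidirect_m E act Q) Q"
  by (auto simp: sg_hom_def semidirect_m_def semidirect_def)

text \<open>For idempotents e \<le> f, the pair (e, [f]) always lies in the full product, because e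
  is below [f] and is fixed by it. If the pair is in the image, then [e] = [f] [f]^-1 = [f];
  arbitrary e and f are joined through e f. Conversely, in a group quotient [e] and A A^-1 are both
  the only idempotent, so the strictness equation holds for every pair.\<close>

lemma emb_surj_iff:
  "emb ` carrier S = carrier (semidirect E act Q) \<longleftrightarrow> group_congruence S \<rho>"
proof
  assume surj: "emb ` carrier S = carrier (semidirect E act Q)"
  have below: "(e, f) \<in> \<rho>" if e: "e \<in> idems S" and f: "f \<in> idems S" and le: "nat_le S e f" for e f
  proof -
    have "e \<in> below (cls f)"
      using below_down[OF below_cls le] f by (simp add: idems_carrier)
    then have "act (cls f) e = Some e"
      using e f by (intro act_below_idem cls_in_Q idems_carrier)
    then have "(e, cls f) \<in> carrier (semidirect_m E act Q)"
      using surj emb_image f by (auto simp: semidirect_carrier ran_def cls_in_Q idems_carrier)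
    then have "cls e = cls f"
      using f by (simp add: semidirect_m_carrier sinv_cls cls_mult idems_carrier sinv_idem)
        (simp add: idems_def)
    then show ?thesis using e f by (simp add: cls_eq_iff idems_carrier)
  qed
  have "(e, f) \<in> \<rho>" if "e \<in> idems S" "f \<in> idems S" for e f
  proof (rule rho_trans[OF rho_sym])
    show "(e \<cdot> f, e) \<in> \<rho>" "(e \<cdot> f, f) \<in> \<rho>"
      using that by (auto intro!: below idems_mult_closed nat_le_left nat_le_right idems_carrier)
  qed
  then show "group_congruence S \<rho>" by (simp add: group_congruence_iff_idems)
next
  assume G: "group_congruence S \<rho>"
  have "cls e = A \<cdot>\<^bsub>Q\<^esub> sinv Q A" if "A \<in> carrier Q" "e \<in> ran (act A)" for e A
  proof (rule is_group_unique_idem[of Q])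
    show "is_group Q" using G by (simp add: group_congruence_def)
    show "cls e \<in> idems Q" using that act_idems by (auto simp: idems_Q ran_def)
    show "A \<cdot>\<^bsub>Q\<^esub> sinv Q A \<in> idems Q" using that(1) by (rule Q.idem_range_dom)
  qed
  then show "emb ` carrier S = carrier (semidirect E act Q)"
    by (auto simp: emb_image semidirect_m_carrier semidirect_carrier)
qed

end

theorem theorem3p4:
  fixes S :: "'a magma" and \<rho> :: "('a \<times> 'a) set"
  assumes "inverse_semigroup S"
    and "congruence S \<rho>"
    and "idempotent_pure S \<rho>"
  shows "\<exists>(\<tau> :: 'a set \<Rightarrow> 'a \<rightharpoonup> 'a) (\<phi> :: 'a \<Rightarrow> 'a \<times> 'a set).
    fully_strict_partial_action (quot S \<rho>) (idem_semilattice S) \<tau> \<and>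
    \<phi> \<in> sg_hom S (semidirect (idem_semilattice S) \<tau> (quot S \<rho>)) \<and>
    inj_on \<phi> (carrier S) \<and>
    \<comment> \<open>(i)\<close>
    \<phi> ` carrier S = carrier (semidirect_m (idem_semilattice S) \<tau> (quot S \<rho>)) \<and>
    \<comment> \<open>(ii)\<close>
    snd \<in> sg_hom (semidirect_m (idem_semilattice S) \<tau> (quot S \<rho>)) (quot S \<rho>) \<and>
    snd ` carrier (semidirect_m (idem_semilattice S) \<tau> (quot S \<rho>)) = carrier (quot S \<rho>) \<and>
    (\<forall>s \<in> carrier S. \<forall>t \<in> carrier S. (s, t) \<in> \<rho> \<longleftrightarrow> snd (\<phi> s) = snd (\<phi> t)) \<and>
    \<comment> \<open>(iii)\<close>
    (\<phi> ` carrier S = carrier (semidirect (idem_semilattice S) \<tau> (quot S \<rho>)) \<longleftrightarrow>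
       group_congruence S \<rho>) \<and>
    (group_congruence S \<rho> \<longleftrightarrow> E_unitary S \<and> \<rho> = min_group_cong S)"
proof -
  interpret pure_congruence S \<rho>
    using assms by (intro pure_congruence.intro pure_congruence_axioms.intro)
  have "fully_strict_partial_action Q E act"
    by (simp add: fully_strict_partial_action_def strict_partial_action_act snd_semidirect_m)
  moreover have "(s, t) \<in> \<rho> \<longleftrightarrow> snd (emb s) = snd (emb t)"
    if "s \<in> carrier S" "t \<in> carrier S" for s t
    using that by (simp add: emb_def cls_eq_iff)
  ultimately show ?thesis
    using emb_hom emb_inj emb_image snd_hom snd_semidirect_m emb_surj_iff group_congruence_iff_sigma
    by (intro exI[of _ act] exI[of _ emb]) simp
qed

end
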